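(* Let $N\ge1$ be an integer, let $q\ge\frac{3}{N+1}$, and let $Y=\{y_1,\dots,y_M\}\subset[0,1)$ and $Y'=\{y_1',\dots,y_{M'}'\}\subset[0,1)$ be two $q$-separated sets of frequencies. Assume further that for each $y\in Y$ there is at most one $y'\in Y'$ such that $|y-y'|_{\mathbb{T}}<q$. Let $\tau$ be the smallest of the distances between the two sets, i.e. $\tau=\operatorname{dist}_{\mathbb{T}}(Y,Y')=\min_{y\in Y,\,y'\in Y'}|y-y'|_{\mathbb{T}}$. Then the smallest singular value $\sigma_{\min}$ of the Vandermonde matrix $V_N(y_1,\dots,y_M,y_1',\dots,y_{M'}')$ satisfies $$\sigma_{\min}^2\ \ge\ \frac{\pi^2}{2\cdot3^5}(N+1)^3\tau^2\qquad\text{if }\tau<\frac{3}{N+1},$$ and $$\sigma_{\min}^2\ \ge\ \frac23(N+1)\qquad\text{otherwise.}$$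
   Context: For $z_1,\dots,z_L\in[0,1)$, $V_N(z_1,\dots,z_L)\in\mathbb{C}^{N\times L}$ is the matrix whose entry in row $k\in\{0,\dots,N-1\}$ and column $j\in\{1,\dots,L\}$ is $e^{2\pi i k z_j}$. The wrap-around distance is $|y-y'|_{\mathbb{T}}=\min_{k\in\mathbb{Z}}|y-y'-k|$. A finite set $Y\subset[0,1)$ is $q$-separated if $|y-y'|_{\mathbb{T}}\ge q$ for all $y\ne y'$ in $Y$. The elements listed in $Y$ (respectively in $Y'$) are pairwise distinct. *)

theory Defs
  imports Complex_Main
    "Jordan_Normal_Form.Char_Poly"
    "Jordan_Normal_Form.Schur_Decomposition"
begin

definition vandermonde_mat :: "nat \<Rightarrow> real list \<Rightarrow> complex mat" where
  "vandermonde_mat N zs =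
     mat N (length zs) (\<lambda>(k, j). exp (2 * complex_of_real pi * \<i> * of_nat k * of_real (zs ! j)))"

(* The infimum is attained, since only finitely many integers k give a value below a given bound. *)
definition wrap_dist :: "real \<Rightarrow> real \<Rightarrow> real" where
  "wrap_dist y y' = (INF k::int. \<bar>y - y' - of_int k\<bar>)"

definition q_separated :: "real \<Rightarrow> real set \<Rightarrow> bool" where
  "q_separated q Y \<longleftrightarrow> (\<forall>y\<in>Y. \<forall>y'\<in>Y. y \<noteq> y' \<longrightarrow> q \<le> wrap_dist y y')"

(* Meant for finite nonempty Y and Y'. *)
definition wrap_set_dist :: "real set \<Rightarrow> real set \<Rightarrow> real" where
  "wrap_set_dist Y Y' = Min {wrap_dist y y' | y y'. y \<in> Y \<and> y' \<in> Y'}"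

(* An m x n matrix has min m n singular values: the square roots of the eigenvalues of the
   smaller one of the two Gram matrices A^H A (n x n) and A A^H (m x m). Multiplicities are
   not recorded, which does not affect the smallest singular value. *)
definition singular_values :: "complex mat \<Rightarrow> real set" where
  "singular_values A =
     {s. 0 \<le> s \<and> eigenvalue (if dim_col A \<le> dim_row A then mat_adjoint A * A else A * mat_adjoint A)
                      (complex_of_real (s\<^sup>2))}"

(* Meant for matrices with at least one row and one column. *)
definition sigma_min :: "complex mat \<Rightarrow> real" where
  "sigma_min A = Min (singular_values A)"

end

theory Submission
  imports
    "HOL-Analysis.Equivalence_Lebesgue_Henstock_Integration"
    "HOL-Analysis.Weierstrass_Theorems"
    "Jordan_Normal_Form.Spectral_Radius"
    Defs
begin

text \<open>
  Write \<open>F(k)\<close> for the sum of \<open>c(y) exp(2\<pi>iky)\<close> over all nodes \<open>y\<close>. If the matrix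
  has at least as many rows as columns, the square of its smallest singular value is the largest constant \<open>b\<close> such that the sum of \<open>|F(k)|\<^sup>2\<close> over \<open>0 \<le> k < N\<close> is at least
  \<open>b\<close> times the sum of \<open>|c(y)|\<^sup>2\<close>. Put \<open>\<delta> = 3/(N+1)\<close>.

  The lower bound comes from a minorant of the window \<open>{0, ..., N-1}\<close> whose Fourier transform has small
  support, in the manner of Beurling and Selberg. Let
  \<open>h(t) = (1-t) cos(\<pi>t) + sin(3\<pi>t)/(3\<pi>)\<close> on \<open>[0,1]\<close>, continued evenly, and by \<open>0\<close> outside \<open>[-1,1]\<close>.
  Its Fourier transform \<open>\<psi>(\<eta>)\<close> is at most \<open>1/2\<close> everywhere and at most \<open>0\<close> for \<open>|\<eta>| \<ge> 3/2\<close>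
  (\<open>kern_coeff_le\<close> and \<open>kern_coeff_nonpos\<close>, where \<open>kern_coeff\<close> is \<open>\<psi>/2\<close>).
  Hence the weights \<open>\<delta>\<psi>(\<delta>(k-(N-1)/2))\<close> are at most \<open>\<delta>/2\<close> inside the window and at most \<open>0\<close> outside it.
  Summing these weights times \<open>|F(k)|\<^sup>2\<close> over all integers \<open>k\<close> and applying Poisson summation turns the sum into the
  quadratic form with entries of modulus \<open>|h(d/\<delta>)|\<close>, where \<open>d\<close> is the wrap-around distance of two nodes.
  The result is \<open>kern_minorant_inequality\<close>: \<open>\<delta>/2\<close> times the sum of \<open>|F(k)|\<^sup>2\<close> over the window is at least
  the sum of \<open>|c(y)|\<^sup>2\<close> minus the contributions of pairs of different nodes at distance below \<open>\<delta>\<close>. The instance of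
  Poisson summation that is needed is the convergence of a cosine series (\<open>cosine_series_sums\<close>).

  If all nodes are \<open>\<delta>\<close>-separated, no pair contributes, and the constant is \<open>2/\<delta> = 2(N+1)/3\<close>.

  Otherwise only pairs from \<open>Y \<times> Y'\<close> contribute. Every \<open>y\<close> has at most one partner, and a
  point \<open>y'\<close> has at most two, one on each side, at distances \<open>u\<delta>\<close> and \<open>v\<delta>\<close> with \<open>u + v \<ge> 1\<close> because \<open>Y\<close> is
  separated. For such \<open>u, v \<ge> x = \<tau>/\<delta>\<close> one has \<open>h(u)\<^sup>2 + h(v)\<^sup>2 \<le> (1 - (\<pi>x/6)\<^sup>2)\<^sup>2\<close> (\<open>kern_pair_bound\<close>),
  since \<open>h\<close> falls quadratically at \<open>0\<close> and vanishes to third order at \<open>1\<close>. The inequality of arithmetic and geometric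
  means then bounds the mixed terms by \<open>1 - (\<pi>x/6)\<^sup>2\<close> times the diagonal (\<open>bilinear_form_le\<close>), and
  \<open>(2/\<delta>)(\<pi>x/6)\<^sup>2 = \<pi>\<^sup>2(N+1)\<^sup>3\<tau>\<^sup>2/(2\<sqdot>3\<^sup>5)\<close> is the asserted constant.

  Poisson summation in this form wants \<open>\<delta> \<le> 1/2\<close>, that is \<open>N \<ge> 5\<close>. For smaller \<open>N\<close> separation leaves one node in each
  set. Two rows of the matrix suffice if \<open>2 \<le> N \<le> 4\<close> (\<open>two_node_lower_bound\<close>). For \<open>N = 1\<close> the matrix has more columns than
  rows, and its only singular value is the norm of its single row.
\<close>

section \<open>Cosine series\<close>

lemma integral_cos_cos:
  fixes i j :: nat
  shows "((\<lambda>t. cos (pi * real i * t) * cos (pi * real j * t)) has_integral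
           (if i = j then (if i = 0 then 1 else 1 / 2) else 0)) {0..1::real}"
proof -
  have cos_int: "((\<lambda>t. cos (pi * of_int k * t)) has_integral (if k = 0 then 1 else 0)) {0..1::real}" for k :: int
  proof (cases "k = 0")
    case True
    then show ?thesis
      using has_integral_const_real [of "1::real" 0 1] by simp
  next
    case False
    have "((\<lambda>t. cos (pi * of_int k * t)) has_integral
        sin (pi * of_int k * 1) / (pi * of_int k) - sin (pi * of_int k * 0) / (pi * of_int k)) {0..1::real}"
      using False
      by (intro fundamental_theorem_of_calculus)
         (auto intro!: derivative_eq_intros simp: has_real_derivative_iff_has_vector_derivative [symmetric])
    moreover have "sin (pi * of_int k) = 0"
      by (simp add: sin_times_pi_eq_0 mult.commute [of pi])
    ultimately show ?thesis
      using False by simp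
  qed
  have "((\<lambda>t. (cos (pi * of_int (int i - int j) * t) + cos (pi * of_int (int i + int j) * t)) / 2) has_integral
         ((if int i - int j = 0 then 1 else 0) + (if int i + int j = 0 then 1 else 0)) / 2) {0..1::real}"
    by (intro has_integral_divide has_integral_add cos_int)
  moreover have "(cos (pi * of_int (int i - int j) * t) + cos (pi * of_int (int i + int j) * t)) / 2
      = cos (pi * real i * t) * cos (pi * real j * t)" for t :: real
    by (simp add: cos_times_cos algebra_simps)
  moreover have "((if int i - int j = 0 then 1 else 0) + (if int i + int j = 0 then 1 else 0)) / 2
      = (if i = j then (if i = 0 then 1 else 1 / 2) else (0::real))"
    by auto
  ultimately show ?thesis
    by (simp only:)
qed

text \<open>
  The powers of \<open>cos(\<pi>t)\<close> are combinations of the functions \<open>cos(\<pi>jt)\<close>, so \<open>d\<close> is orthogonal to every polynomial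
  in \<open>cos(\<pi>t)\<close>. As \<open>t \<mapsto> cos(\<pi>t)\<close> is a homeomorphism of \<open>[0,1]\<close> onto \<open>[-1,1]\<close>, such polynomials approximate \<open>d\<close>
  uniformly by Weierstrass, and \<open>d\<close> is orthogonal to itself.
\<close>
lemma orthogonal_to_cosines_imp_zero:
  fixes d :: "real \<Rightarrow> real"
  assumes cont: "continuous_on {0..1} d"
    and orth: "\<And>j::nat. integral {0..1} (\<lambda>t. d t * cos (pi * real j * t)) = 0"
    and x: "x \<in> {0..1}"
  shows "d x = 0"
proof -
  have pow: "integral {0..1} (\<lambda>t. d t * (cos (pi * t) ^ n * cos (pi * real j * t))) = 0" for n j
  proof (induction n arbitrary: j)
    case 0
    then show ?case using orth by simp
  next
    case (Suc n)
    have int: "(\<lambda>t. d t * (cos (pi * t) ^ n * cos (pi * real i * t))) integrable_on {0..1}" for i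
      by (intro integrable_continuous_real continuous_intros cont)
    show ?case
    proof (cases j)
      case 0
      then show ?thesis using Suc.IH [of 1] by (simp add: mult_ac)
    next
      case (Suc i)
      have split: "d t * (cos (pi * t) ^ Suc n * cos (pi * real j * t))
          = (d t * (cos (pi * t) ^ n * cos (pi * real (Suc j) * t))
           + d t * (cos (pi * t) ^ n * cos (pi * real i * t))) / 2" for t
      proof -
        have "cos (pi * real (Suc j) * t) + cos (pi * real i * t) = 2 * (cos (pi * t) * cos (pi * real j * t))"
          by (simp add: cos_times_cos Suc algebra_simps)
        then have "d t * cos (pi * t) ^ n * (cos (pi * real (Suc j) * t) + cos (pi * real i * t))
            = d t * cos (pi * t) ^ n * (2 * (cos (pi * t) * cos (pi * real j * t)))"
          by (rule arg_cong)
        then show ?thesis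
          by (simp add: distrib_left mult.assoc)
      qed
      have "integral {0..1} (\<lambda>t. d t * (cos (pi * t) ^ Suc n * cos (pi * real j * t)))
          = (integral {0..1} (\<lambda>t. d t * (cos (pi * t) ^ n * cos (pi * real (Suc j) * t)))
           + integral {0..1} (\<lambda>t. d t * (cos (pi * t) ^ n * cos (pi * real i * t)))) / 2"
        unfolding split by (simp only: integral_divide integral_add [OF int int])
      then show ?thesis
        by (simp only: Suc.IH) simp
    qed
  qed
  have poly: "integral {0..1} (\<lambda>t. d t * p (cos (pi * t))) = 0" if pp: "real_polynomial_function p" for p
  proof -
    obtain a n where p: "p = (\<lambda>x. \<Sum>i\<le>n. a i * x ^ i)"
      using pp real_polynomial_function_iff_sum [of p] by metis
    have "integral {0..1} (\<lambda>t. d t * p (cos (pi * t)))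
        = integral {0..1} (\<lambda>t. \<Sum>i\<le>n. a i * (d t * (cos (pi * t) ^ i * cos (pi * real 0 * t))))"
      by (simp add: p sum_distrib_left mult_ac)
    also have "\<dots> = (\<Sum>i\<le>n. integral {0..1} (\<lambda>t. a i * (d t * (cos (pi * t) ^ i * cos (pi * real 0 * t)))))"
      by (intro integral_sum integrable_continuous_real continuous_intros cont) auto
    also have "\<dots> = 0"
      using pow [where j = 0] by (simp del: of_nat_0)
    finally show ?thesis .
  qed
  (* \<open>\<integral>d\<^sup>2 = \<integral>d(d - p(cos \<pi>t))\<close> for each polynomial \<open>p\<close> *)
  have small: "integral {0..1} (\<lambda>t. (d t)\<^sup>2) \<le> e * integral {0..1} (\<lambda>t. \<bar>d t\<bar>)" if e: "e > 0" for e
  proof -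
    have "continuous_on {-1..1} (\<lambda>y. d (arccos y / pi))"
      by (rule continuous_on_compose2 [OF cont])
         (auto intro!: continuous_intros simp: arccos_lbound arccos_ubound)
    from Stone_Weierstrass_real_polynomial_function [OF compact_Icc this e]
    obtain p where p: "real_polynomial_function p"
        "\<And>y. y \<in> {-1..1} \<Longrightarrow> \<bar>d (arccos y / pi) - p y\<bar> < e"
      by blast
    have approx: "\<bar>d t - p (cos (pi * t))\<bar> \<le> e" if "t \<in> {0..1}" for t
      using p(2) [of "cos (pi * t)"] that by (simp add: arccos_cos less_imp_le)
    have contp: "continuous_on {0..1} (\<lambda>t. p (cos (pi * t)))"
      by (rule continuous_on_compose2 [OF continuous_on_polymonial_function [of p UNIV]])
         (use p(1) in \<open>auto intro!: continuous_intros simp: real_polynomial_function_eq\<close>)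
    have "integral {0..1} (\<lambda>t. (d t)\<^sup>2) = integral {0..1} (\<lambda>t. d t * (d t - p (cos (pi * t))))"
    proof -
      have "integral {0..1} (\<lambda>t. d t * d t - d t * p (cos (pi * t)))
          = integral {0..1} (\<lambda>t. d t * d t) - integral {0..1} (\<lambda>t. d t * p (cos (pi * t)))"
        by (intro integral_diff integrable_continuous_real continuous_intros cont contp)
      then show ?thesis
        using poly [OF p(1)] by (simp only: right_diff_distrib power2_eq_square)
    qed
    also have "\<dots> \<le> integral {0..1} (\<lambda>t. e * \<bar>d t\<bar>)"
    proof (rule integral_le)
      fix t :: real
      assume "t \<in> {0..1}"
      then have "\<bar>d t\<bar> * \<bar>d t - p (cos (pi * t))\<bar> \<le> \<bar>d t\<bar> * e"
        by (intro mult_left_mono approx) auto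
      then show "d t * (d t - p (cos (pi * t))) \<le> e * \<bar>d t\<bar>"
        using abs_ge_self [of "d t * (d t - p (cos (pi * t)))"]
        unfolding abs_mult by (simp only: mult.commute [of e])
    qed (intro integrable_continuous_real continuous_intros cont contp)+
    finally show ?thesis by simp
  qed
  have "integral {0..1} (\<lambda>t. (d t)\<^sup>2) \<le> 0"
  proof (rule field_le_epsilon)
    fix e :: real
    assume e: "e > 0"
    define K where "K = integral {0..1} (\<lambda>t. \<bar>d t\<bar>)"
    have "K \<ge> 0"
      unfolding K_def by (intro integral_nonneg integrable_continuous_real continuous_intros cont) auto
    then have "e / (K + 1) * K \<le> e"
      using e by (simp add: field_simps)
    then show "integral {0..1} (\<lambda>t. (d t)\<^sup>2) \<le> 0 + e"
      using small [of "e / (K + 1)"] e \<open>K \<ge> 0\<close> unfolding K_def [symmetric] by simp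
  qed
  then have "integral {0..1} (\<lambda>t. (d t)\<^sup>2) = 0"
    by (intro antisym integral_nonneg integrable_continuous_real continuous_intros cont) auto
  moreover have "continuous_on {0..1} (\<lambda>t. (d t)\<^sup>2)"
    by (intro continuous_intros cont)
  ultimately have "(d x)\<^sup>2 = 0"
    using integral_eq_0_iff [of 0 1 "\<lambda>t. (d t)\<^sup>2"] x by simp
  then show ?thesis by simp
qed

text \<open>
  If the coefficients are absolutely summable, the series converges uniformly to a continuous function with
  the same cosine coefficients as \<open>f\<close>. The difference is orthogonal to all cosines, hence zero.
\<close>
lemma cosine_series_sums:
  fixes f :: "real \<Rightarrow> real" and b :: "nat \<Rightarrow> real"
  assumes cont: "continuous_on {0..1} f"
    and b: "\<And>j. ((\<lambda>t. f t * cos (pi * real j * t)) has_integral b j) {0..1}"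
    and summ: "summable (\<lambda>j. \<bar>b j\<bar>)"
    and x: "x \<in> {0..1}"
  shows "(\<lambda>j. (if j = 0 then 1 else 2) * b j * cos (pi * real j * x)) sums f x"
proof -
  define a where "a j = (if j = 0 then 1 else 2) * b j" for j
  define g where "g t = (\<Sum>j. a j * cos (pi * real j * t))" for t
  have bd: "norm (a j * cos (pi * real j * t)) \<le> 2 * \<bar>b j\<bar>" for j t
    using mult_mono [of "\<bar>a j\<bar>" "2 * \<bar>b j\<bar>" "\<bar>cos (pi * real j * t)\<bar>" 1]
    by (auto simp: a_def abs_mult)
  have summ2: "summable (\<lambda>j. 2 * \<bar>b j\<bar>)"
    using summ by (rule summable_mult)
  have unif: "uniform_limit {0..1} (\<lambda>n t. \<Sum>j<n. a j * cos (pi * real j * t)) g sequentially"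
    unfolding g_def by (rule Weierstrass_m_test [OF bd summ2])
  have contg: "continuous_on {0..1} g"
    by (rule uniform_limit_theorem [OF _ unif]) (auto intro!: continuous_intros always_eventually)
  have orth: "integral {0..1} (\<lambda>t. (f t - g t) * cos (pi * real i * t)) = 0" for i
  proof -
    have unif': "uniform_limit {0..1} (\<lambda>n t. (\<Sum>j<n. a j * cos (pi * real j * t)) * cos (pi * real i * t))
        (\<lambda>t. g t * cos (pi * real i * t)) sequentially"
      by (intro uniform_lim_mult unif uniform_limit_const compact_imp_bounded compact_continuous_image
          contg continuous_intros) auto
    have c: "continuous_on {0..1} (\<lambda>t. (\<Sum>j<n. a j * cos (pi * real j * t)) * cos (pi * real i * t))" for n
      by (intro continuous_intros)
    obtain I J where I: "\<And>n. ((\<lambda>t. (\<Sum>j<n. a j * cos (pi * real j * t)) * cos (pi * real i * t)) has_integral I n) {0..1}"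
      and J: "((\<lambda>t. g t * cos (pi * real i * t)) has_integral J) {0..1}" and lim: "I \<longlonglongrightarrow> J"
      using uniform_limit_integral [OF unif' c sequentially_bot] by blast
    have "I n = b i" if "n > i" for n
    proof -
      have "((\<lambda>t. \<Sum>j<n. a j * (cos (pi * real j * t) * cos (pi * real i * t))) has_integral
             (\<Sum>j<n. a j * (if j = i then (if j = 0 then 1 else 1 / 2) else 0))) {0..1}"
        by (intro has_integral_sum has_integral_mult_right integral_cos_cos) auto
      moreover have "(\<Sum>j<n. a j * (if j = i then (if j = 0 then 1 else 1 / 2) else 0)) = b i"
        using that by (simp add: if_distrib [of "\<lambda>c. _ * c"] a_def cong: if_cong)
      ultimately show ?thesis
        using has_integral_unique [OF I [of n]] by (simp add: sum_distrib_right mult.assoc)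
    qed
    then have "J = b i"
      using lim by (intro LIMSEQ_unique [OF lim]) (auto intro!: tendsto_eventually eventually_sequentiallyI [of "Suc i"])
    then show ?thesis
      using has_integral_diff [OF b [of i] J] by (simp add: left_diff_distrib integral_unique)
  qed
  have "f x - g x = 0"
    by (rule orthogonal_to_cosines_imp_zero [OF _ orth x]) (intro continuous_intros cont contg)
  moreover have "(\<lambda>j. a j * cos (pi * real j * x)) sums g x"
    unfolding g_def
    by (intro summable_sums summable_comparison_test' [OF summ2, of 0] bd)
  ultimately show ?thesis
    by (simp add: a_def)
qed

section \<open>The kernel and its cosine transform\<close>

lemma integral_one_minus_times_cos:
  assumes "b \<noteq> 0"
  shows "((\<lambda>t. (1 - t) * cos (b * t)) has_integral (1 - cos b) / b\<^sup>2) {0..1::real}"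
proof -
  let ?F = "\<lambda>t. (1 - t) * sin (b * t) / b - cos (b * t) / b\<^sup>2"
  have "((\<lambda>t. (1 - t) * cos (b * t)) has_integral ?F 1 - ?F 0) {0..1}"
    using assms
    by (intro fundamental_theorem_of_calculus)
       (auto intro!: derivative_eq_intros simp: has_real_derivative_iff_has_vector_derivative [symmetric]
          field_simps power2_eq_square)
  then show ?thesis
    by (simp add: diff_divide_distrib)
qed

lemma integral_one_minus: "((\<lambda>t. 1 - t) has_integral 1 / 2) {0..1::real}"
proof -
  let ?F = "\<lambda>t::real. t - t\<^sup>2 / 2"
  have "((\<lambda>t. 1 - t) has_integral ?F 1 - ?F 0) {0..1}"
    by (intro fundamental_theorem_of_calculus)
       (auto intro!: derivative_eq_intros simp: has_real_derivative_iff_has_vector_derivative [symmetric])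
  then show ?thesis
    by simp
qed

lemma integral_sin: "((\<lambda>t. sin (b * t)) has_integral (1 - cos b) / b) {0..1::real}"
proof (cases "b = 0")
  case False
  let ?F = "\<lambda>t. - cos (b * t) / b"
  have "((\<lambda>t. sin (b * t)) has_integral ?F 1 - ?F 0) {0..1}"
    using False
    by (intro fundamental_theorem_of_calculus)
       (auto intro!: derivative_eq_intros simp: has_real_derivative_iff_has_vector_derivative [symmetric])
  then show ?thesis
    by (simp add: diff_divide_distrib)
qed auto

text \<open>
  On \<open>[0,1]\<close> this is the function \<open>h\<close> of the introduction, and \<open>2h\<close> is the Fourier transform of the function
  \<open>(sin(\<pi>x)/\<pi>)\<^sup>2 (1/(x-1)\<^sup>2 + 1/(x-2)\<^sup>2 + 2/(3x) - 2/(3(x-3)))\<close> after its centre \<open>3/2\<close> is moved to \<open>0\<close>.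
  This function interpolates the indicator function of the open interval \<open>(0,3)\<close> at the integers. The weight \<open>2/3\<close> of the
  last two fractions makes the derivative of \<open>h\<close> vanish at \<open>0\<close>, so that \<open>1 - h\<close> is quadratic there.
\<close>
definition kern :: "real \<Rightarrow> real" where
  "kern t = (1 - t) * cos (pi * t) + sin (3 * pi * t) / (3 * pi)"

definition kern_coeff :: "real \<Rightarrow> real" where
  "kern_coeff \<eta> = integral {0..1} (\<lambda>t. kern t * cos (2 * pi * \<eta> * t))"

lemma kern_has_integral:
  "((\<lambda>t. kern t * cos (2 * pi * \<eta> * t)) has_integral kern_coeff \<eta>) {0..1}"
  unfolding kern_coeff_def kern_def
  by (intro integrable_integral integrable_continuous_real continuous_intros) auto

text \<open>
  The two integrals are parameters because their closed form has a pole where the frequency vanishes, namely at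
  \<open>\<eta> = \<plusminus>1/2\<close>. The sine terms need no such care, as division by \<open>0\<close> gives their correct value \<open>0\<close>.
\<close>
lemma kern_coeff_eqI:
  assumes "((\<lambda>t. (1 - t) * cos (pi * (2 * \<eta> + 1) * t)) has_integral p) {0..1}"
    and "((\<lambda>t. (1 - t) * cos (pi * (2 * \<eta> - 1) * t)) has_integral q) {0..1}"
  shows "kern_coeff \<eta> = (p + q) / 2 +
     ((1 + cos (2 * pi * \<eta>)) / (pi * (3 + 2 * \<eta>)) + (1 + cos (2 * pi * \<eta>)) / (pi * (3 - 2 * \<eta>))) / (6 * pi)"
proof -
  have 1: "cos (pi * (3 + 2 * \<eta>)) = - cos (2 * pi * \<eta>)" "cos (pi * (3 - 2 * \<eta>)) = - cos (2 * pi * \<eta>)"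
    using cos_periodic_pi [of "2 * pi + 2 * pi * \<eta>"] cos_periodic_pi [of "2 * pi - 2 * pi * \<eta>"]
      cos_periodic [of "2 * pi * \<eta>"] cos_periodic [of "- (2 * pi * \<eta>)"]
    by (simp_all add: algebra_simps)
  have "((\<lambda>t. ((1 - t) * cos (pi * (2 * \<eta> + 1) * t) + (1 - t) * cos (pi * (2 * \<eta> - 1) * t)) / 2
        + (sin (pi * (3 + 2 * \<eta>) * t) + sin (pi * (3 - 2 * \<eta>) * t)) / (6 * pi)) has_integral
      (p + q) / 2 + ((1 - cos (pi * (3 + 2 * \<eta>))) / (pi * (3 + 2 * \<eta>))
        + (1 - cos (pi * (3 - 2 * \<eta>))) / (pi * (3 - 2 * \<eta>))) / (6 * pi)) {0..1}"
    by (intro has_integral_add has_integral_divide assms integral_sin)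
  moreover have "((1 - t) * cos (pi * (2 * \<eta> + 1) * t) + (1 - t) * cos (pi * (2 * \<eta> - 1) * t)) / 2
        + (sin (pi * (3 + 2 * \<eta>) * t) + sin (pi * (3 - 2 * \<eta>) * t)) / (6 * pi)
        = kern t * cos (2 * pi * \<eta> * t)" for t
  proof -
    have 2: "pi * (2 * \<eta> + 1) * t = 2 * pi * \<eta> * t + pi * t" "pi * (2 * \<eta> - 1) * t = 2 * pi * \<eta> * t - pi * t"
      "pi * (3 + 2 * \<eta>) * t = 3 * pi * t + 2 * pi * \<eta> * t" "pi * (3 - 2 * \<eta>) * t = 3 * pi * t - 2 * pi * \<eta> * t"
      by (simp_all add: algebra_simps)
    show ?thesis
      unfolding 2 kern_def by (simp add: cos_add cos_diff sin_add sin_diff field_simps)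
  qed
  ultimately have "((\<lambda>t. kern t * cos (2 * pi * \<eta> * t)) has_integral
      (p + q) / 2 + ((1 - cos (pi * (3 + 2 * \<eta>))) / (pi * (3 + 2 * \<eta>))
        + (1 - cos (pi * (3 - 2 * \<eta>))) / (pi * (3 - 2 * \<eta>))) / (6 * pi)) {0..1}"
    by simp
  then show ?thesis
    unfolding 1 using has_integral_unique [OF kern_has_integral] by simp
qed

lemma kern_coeff_eq:
  assumes "\<bar>\<eta>\<bar> \<noteq> 1 / 2" "\<bar>\<eta>\<bar> \<noteq> 3 / 2"
  shows "kern_coeff \<eta> = (cos (pi * \<eta>))\<^sup>2 / (4 * pi\<^sup>2) *
           (1 / (\<eta> + 1 / 2)\<^sup>2 + 1 / (\<eta> - 1 / 2)\<^sup>2 + 2 / (9 / 4 - \<eta>\<^sup>2))"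
proof -
  have nz: "2 * \<eta> + 1 \<noteq> 0" "2 * \<eta> - 1 \<noteq> 0" "3 + 2 * \<eta> \<noteq> 0" "3 - 2 * \<eta> \<noteq> 0"
    using assms by auto
  have c: "cos (pi * (2 * \<eta> + 1)) = - cos (2 * pi * \<eta>)" "cos (pi * (2 * \<eta> - 1)) = - cos (2 * pi * \<eta>)"
    using cos_periodic_pi [of "2 * pi * \<eta>"] cos_minus_pi [of "2 * pi * \<eta>"] by (simp_all add: algebra_simps)
  have d: "1 + cos (2 * pi * \<eta>) = 2 * (cos (pi * \<eta>))\<^sup>2"
    using cos_double_cos [of "pi * \<eta>"] by (simp add: mult.assoc)
  have e: "\<eta> + 1 / 2 = (2 * \<eta> + 1) / 2" "\<eta> - 1 / 2 = (2 * \<eta> - 1) / 2"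
     "9 / 4 - \<eta>\<^sup>2 = (3 + 2 * \<eta>) * (3 - 2 * \<eta>) / 4"
    by (simp_all add: field_simps power2_eq_square)
  have f: "1 / (3 + 2 * \<eta>) + 1 / (3 - 2 * \<eta>) = 6 / ((3 + 2 * \<eta>) * (3 - 2 * \<eta>))"
    using nz by (simp add: field_simps)
  have "kern_coeff \<eta> = ((1 - cos (pi * (2 * \<eta> + 1))) / (pi * (2 * \<eta> + 1))\<^sup>2
        + (1 - cos (pi * (2 * \<eta> - 1))) / (pi * (2 * \<eta> - 1))\<^sup>2) / 2
        + ((1 + cos (2 * pi * \<eta>)) / (pi * (3 + 2 * \<eta>)) + (1 + cos (2 * pi * \<eta>)) / (pi * (3 - 2 * \<eta>))) / (6 * pi)"
    using nz by (intro kern_coeff_eqI integral_one_minus_times_cos) auto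
  also have "\<dots> = (cos (pi * \<eta>))\<^sup>2 / pi\<^sup>2 *
     (1 / (2 * \<eta> + 1)\<^sup>2 + 1 / (2 * \<eta> - 1)\<^sup>2 + (1 / (3 + 2 * \<eta>) + 1 / (3 - 2 * \<eta>)) / 3)"
  proof -
    have "1 - - cos (2 * pi * \<eta>) = 2 * (cos (pi * \<eta>))\<^sup>2"
      using d by simp
    then show ?thesis
      unfolding c d using nz by (simp add: power_mult_distrib divide_simps) (simp add: algebra_simps power2_eq_square)
  qed
  also have "\<dots> = (cos (pi * \<eta>))\<^sup>2 / (4 * pi\<^sup>2) *
           (1 / (\<eta> + 1 / 2)\<^sup>2 + 1 / (\<eta> - 1 / 2)\<^sup>2 + 2 / (9 / 4 - \<eta>\<^sup>2))"
  proof -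
    have "C / pi\<^sup>2 * (1 / A + 1 / B + 6 / P / 3) = C / (4 * pi\<^sup>2) * (1 / (A / 2\<^sup>2) + 1 / (B / 2\<^sup>2) + 2 / (P / 4))"
      for A B C P :: real
      by (simp add: distrib_left)
    then show ?thesis
      unfolding e f power_divide .
  qed
  finally show ?thesis .
qed

lemma kern_coeff_half: "kern_coeff (1 / 2) = 1 / 4"
proof -
  have "kern_coeff (1 / 2) = ((1 - cos (2 * pi)) / (2 * pi)\<^sup>2 + 1 / 2) / 2 +
     ((1 + cos (2 * pi * (1 / 2))) / (pi * (3 + 2 * (1 / 2))) + (1 + cos (2 * pi * (1 / 2))) / (pi * (3 - 2 * (1 / 2)))) / (6 * pi)"
    using integral_one_minus_times_cos [of "2 * pi"] integral_one_minus
    by (intro kern_coeff_eqI) (simp_all add: mult.commute [of pi])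
  then show ?thesis by simp
qed

lemma kern_coeff_three_halves: "kern_coeff (3 / 2) = 0"
proof -
  have c: "cos (2 * pi * (3 / 2)) = - 1"
    using cos_periodic [of pi] by (simp add: algebra_simps)
  have "kern_coeff (3 / 2) = ((1 - cos (4 * pi)) / (4 * pi)\<^sup>2 + (1 - cos (2 * pi)) / (2 * pi)\<^sup>2) / 2 +
     ((1 + cos (2 * pi * (3 / 2))) / (pi * (3 + 2 * (3 / 2))) + (1 + cos (2 * pi * (3 / 2))) / (pi * (3 - 2 * (3 / 2)))) / (6 * pi)"
    using integral_one_minus_times_cos [of "2 * pi"] integral_one_minus_times_cos [of "4 * pi"]
    by (intro kern_coeff_eqI) (simp_all add: mult.commute [of pi])
  moreover have "cos (4 * pi) = 1"
    using cos_periodic [of "2 * pi"] by simp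
  ultimately show ?thesis by (simp add: c)
qed

text \<open>
  This is the partial fraction expansion of \<open>\<pi>\<^sup>2/sin\<^sup>2(\<pi>x)\<close>, truncated to \<open>2\<^sup>m\<close> consecutive integers. The induction halves the argument:
  \<open>sin\<^sup>2(\<pi>x) = 4 sin\<^sup>2(\<pi>x/2) cos\<^sup>2(\<pi>x/2)\<close>, and the even and the odd shifts are dealt with by the induction
  hypothesis at \<open>x/2\<close> and at \<open>(x+1)/2\<close>. The form without division also covers integers \<open>x\<close>.
\<close>
lemma sin_squared_times_sum_le:
  "(sin (pi * x))\<^sup>2 * (\<Sum>k<2 ^ m. 1 / (x + real k)\<^sup>2) \<le> pi\<^sup>2"
proof (induction m arbitrary: x)
  case 0
  have "\<bar>sin (pi * x)\<bar> \<le> pi * \<bar>x\<bar>"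
    using abs_sin_x_le_abs_x [of "pi * x"] by (simp add: abs_mult)
  then have "(sin (pi * x))\<^sup>2 \<le> (pi * \<bar>x\<bar>)\<^sup>2"
    using power_mono [of "\<bar>sin (pi * x)\<bar>" "pi * \<bar>x\<bar>" 2] by simp
  then show ?case
    by (cases "x = 0") (simp_all add: power_mult_distrib field_simps)
next
  case (Suc m)
  define s c where "s = (sin (pi * (x / 2)))\<^sup>2" and "c = (cos (pi * (x / 2)))\<^sup>2"
  define S T where "S = (\<Sum>k<2 ^ m. 1 / (x / 2 + real k)\<^sup>2)" and "T = (\<Sum>k<2 ^ m. 1 / ((x + 1) / 2 + real k)\<^sup>2)"
  have sc: "s \<ge> 0" "c \<ge> 0" "s + c = 1"
    by (simp_all add: s_def c_def)
  have "s * S \<le> pi\<^sup>2"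
    using Suc.IH [of "x / 2"] by (simp add: s_def S_def)
  moreover have "c * T \<le> pi\<^sup>2"
    using Suc.IH [of "(x + 1) / 2"] sin_cos_eq [of "pi * ((x + 1) / 2)"] 
    by (simp add: c_def T_def field_simps sin_add)
  ultimately have *: "c * (s * S) + s * (c * T) \<le> c * pi\<^sup>2 + s * pi\<^sup>2"
    using sc by (intro add_mono mult_left_mono) auto
  have "(\<Sum>k<2 ^ Suc m. 1 / (x + real k)\<^sup>2) = (\<Sum>k<2 ^ m * 2. 1 / (x + real k)\<^sup>2)"
    by (simp add: mult.commute)
  also have "\<dots> = (\<Sum>k<2 ^ m. 1 / (x + real (2 * k))\<^sup>2 + 1 / (x + real (2 * k + 1))\<^sup>2)"
  proof -
    have "(\<Sum>k<M * 2. g k) = (\<Sum>k<M. g (2 * k) + g (2 * k + 1))" for g :: "nat \<Rightarrow> real" and M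
      by (induction M) (simp_all add: mult.commute)
    then show ?thesis .
  qed
  also have "\<dots> = (S + T) / 4"
  proof -
    have "1 / (x / 2 + real k)\<^sup>2 = 4 * (1 / (x + real (2 * k))\<^sup>2)" 
         "1 / ((x + 1) / 2 + real k)\<^sup>2 = 4 * (1 / (x + real (2 * k + 1))\<^sup>2)" for k
    proof -
      have "x / 2 + real k = (x + real (2 * k)) / 2" "(x + 1) / 2 + real k = (x + real (2 * k + 1)) / 2"
        by simp_all
      then show "1 / (x / 2 + real k)\<^sup>2 = 4 * (1 / (x + real (2 * k))\<^sup>2)" 
         "1 / ((x + 1) / 2 + real k)\<^sup>2 = 4 * (1 / (x + real (2 * k + 1))\<^sup>2)"
        by (simp_all only: power_divide) simp_all
    qed
    then show ?thesis
      unfolding S_def T_def by (simp only: sum.distrib flip: sum_distrib_left) simp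
  qed
  finally have "(sin (pi * x))\<^sup>2 * (\<Sum>k<2 ^ Suc m. 1 / (x + real k)\<^sup>2) = s * c * (S + T)"
    using sin_double [of "pi * (x / 2)"] by (simp add: s_def c_def power_mult_distrib)
  moreover have "c * pi\<^sup>2 + s * pi\<^sup>2 = (s + c) * pi\<^sup>2"
    by (simp add: algebra_simps)
  moreover have "c * (s * S) + s * (c * T) = s * c * (S + T)"
    by (simp add: algebra_simps)
  ultimately show ?case
    using * sc(3) by simp
qed

text \<open>
  By telescoping, the sum is at least \<open>1/y - 1/(y+6)\<close>. Six terms are enough for the factor \<open>2/3\<close> when \<open>y \<le> 3\<close>.
\<close>
lemma sum_inverse_squares_ge:
  assumes "0 < y" "y \<le> (3::real)"
  shows "2 / (3 * y) \<le> (\<Sum>n<6. 1 / (y + real n)\<^sup>2)"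
proof -
  have "1 / (y + 6) \<le> 1 / (3 * y)"
    using assms by (intro divide_left_mono) auto
  then have "2 / (3 * y) \<le> 1 / y - 1 / (y + 6)"
    by simp
  also have "1 / y - 1 / (y + 6) = (\<Sum>n<6. 1 / (y + real n) - 1 / (y + real (Suc n)))"
    using sum_lessThan_telescope' [of "\<lambda>n. 1 / (y + real n)" 6] by simp
  also have "\<dots> \<le> (\<Sum>n<6. 1 / (y + real n)\<^sup>2)"
  proof (rule sum_mono)
    fix n
    have "1 / (y + real n) - 1 / (y + real (Suc n)) = 1 / ((y + real n) * (y + real (Suc n)))"
      using assms by (simp add: field_simps)
    also have "\<dots> \<le> 1 / (y + real n)\<^sup>2"
      using assms by (intro divide_left_mono) (auto simp: power2_eq_square intro!: mult_left_mono mult_pos_pos)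
    finally show "1 / (y + real n) - 1 / (y + real (Suc n)) \<le> 1 / (y + real n)\<^sup>2" .
  qed
  finally show ?thesis .
qed

text \<open>
  In the variable \<open>x = \<eta> + 3/2\<close> the last fraction of the closed form is \<open>2/(3x) + 2/(3(3-x))\<close>. It is at most
  the sum of \<open>1/(x-n)\<^sup>2\<close> over the integers \<open>-5 \<le> n \<le> 0\<close> and \<open>3 \<le> n \<le> 8\<close>. The other two fractions are the terms \<open>n = 1\<close> and \<open>n = 2\<close>,
  so everything is part of the expansion of \<open>\<pi>\<^sup>2/sin\<^sup>2(\<pi>x)\<close>.
\<close>
lemma kern_coeff_le:
  assumes "0 \<le> \<eta>" "\<eta> < 3 / 2"
  shows "kern_coeff \<eta> \<le> 1 / 4"
proof (cases "\<eta> = 1 / 2")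
  case True
  then show ?thesis using kern_coeff_half by (simp only:)
next
  case False
  define x where "x = \<eta> + 3 / 2"
  have x: "0 < x" "x < 3" using assms by (auto simp: x_def)
  (* sixteen terms cover all the integers from -7 to 8 that occur *)
  define f where "f k = 1 / (x - 8 + real k)\<^sup>2" for k
  have "9 / 4 - \<eta>\<^sup>2 = x * (3 - x)"
    by (simp add: x_def field_simps power2_eq_square)
  then have "2 / (9 / 4 - \<eta>\<^sup>2) = 2 / (3 * x) + 2 / (3 * (3 - x))"
    using x by (simp add: divide_simps)
  also have "\<dots> \<le> (\<Sum>n<6. 1 / (x + real n)\<^sup>2) + (\<Sum>n<6. 1 / (3 - x + real n)\<^sup>2)"
    using x by (intro add_mono sum_inverse_squares_ge) auto
  also have "(\<Sum>n<6. 1 / (x + real n)\<^sup>2) = f 8 + f 9 + f 10 + f 11 + f 12 + f 13"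
    by (simp add: f_def lessThan_nat_numeral add.commute)
  also have "(\<Sum>n<6. 1 / (3 - x + real n)\<^sup>2) = f 5 + f 4 + f 3 + f 2 + f 1 + f 0"
    by (simp add: f_def lessThan_nat_numeral power2_commute)
  finally have *: "2 / (9 / 4 - \<eta>\<^sup>2) \<le> f 8 + f 9 + f 10 + f 11 + f 12 + f 13 + (f 5 + f 4 + f 3 + f 2 + f 1 + f 0)" .
  have "1 / (\<eta> + 1 / 2)\<^sup>2 = f 7" "1 / (\<eta> - 1 / 2)\<^sup>2 = f 6" "f 14 \<ge> 0" "f 15 \<ge> 0"
    by (simp_all add: f_def x_def add.commute)
  with * have "1 / (\<eta> + 1 / 2)\<^sup>2 + 1 / (\<eta> - 1 / 2)\<^sup>2 + 2 / (9 / 4 - \<eta>\<^sup>2) \<le> (\<Sum>k<2 ^ 4. f k)"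
    by (simp add: eval_nat_numeral)
  then have "(sin (pi * (x - 8)))\<^sup>2 * (1 / (\<eta> + 1 / 2)\<^sup>2 + 1 / (\<eta> - 1 / 2)\<^sup>2 + 2 / (9 / 4 - \<eta>\<^sup>2))
      \<le> (sin (pi * (x - 8)))\<^sup>2 * (\<Sum>k<2 ^ 4. f k)"
    by (intro mult_left_mono) auto
  also have "\<dots> \<le> pi\<^sup>2"
    unfolding f_def by (rule sin_squared_times_sum_le)
  also have "(sin (pi * (x - 8)))\<^sup>2 = (cos (pi * \<eta>))\<^sup>2"
  proof -
    have "pi * (x - 8) = pi * \<eta> - pi / 2 - 6 * pi"
      by (simp add: x_def algebra_simps)
    moreover have "cos (6 * pi) = 1" "sin (6 * pi) = 0"
      using cos_int_2pin [of 3] sin_int_2pin [of 3] by simp_all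
    ultimately have "sin (pi * (x - 8)) = - cos (pi * \<eta>)"
      by (simp only: sin_diff [of _ "6 * pi"] sin_diff [of _ "pi / 2"]) simp
    then show ?thesis by simp
  qed
  finally have "(cos (pi * \<eta>))\<^sup>2 / (4 * pi\<^sup>2) * (1 / (\<eta> + 1 / 2)\<^sup>2 + 1 / (\<eta> - 1 / 2)\<^sup>2 + 2 / (9 / 4 - \<eta>\<^sup>2)) \<le> 1 / 4"
    by (simp add: field_simps)
  then show ?thesis
    using assms False by (simp add: kern_coeff_eq)
qed

lemma kern_coeff_nonpos:
  assumes "\<eta> \<ge> 3 / 2"
  shows "kern_coeff \<eta> \<le> 0"
proof (cases "\<eta> = 3 / 2")
  case True
  then show ?thesis using kern_coeff_three_halves by (simp only:)
next
  case False
  define E where "E = \<eta>\<^sup>2"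
  have E: "E > 9 / 4"
    using assms False power_strict_mono [of "3 / 2" \<eta> 2] by (simp add: E_def power_divide)
  have "1 / (\<eta> + 1 / 2)\<^sup>2 + 1 / (\<eta> - 1 / 2)\<^sup>2 = 2 * (E + 1 / 4) / (E - 1 / 4)\<^sup>2"
  proof -
    have "(E - 1 / 4)\<^sup>2 = (\<eta> + 1 / 2)\<^sup>2 * (\<eta> - 1 / 2)\<^sup>2"
      by (simp add: E_def field_simps power2_eq_square)
    moreover have "2 * (E + 1 / 4) = (\<eta> + 1 / 2)\<^sup>2 + (\<eta> - 1 / 2)\<^sup>2"
      by (simp add: E_def field_simps power2_eq_square)
    ultimately show ?thesis
      using assms by (simp add: add_frac_eq)
  qed
  also have "\<dots> \<le> 2 / (E - 9 / 4)"
  proof -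
    have "2 * (E + 1 / 4) * (E - 9 / 4) \<le> 2 * (E - 1 / 4)\<^sup>2"
      using E by (simp add: field_simps power2_eq_square)
    then show ?thesis
      using E by (simp add: pos_divide_le_eq pos_le_divide_eq)
  qed
  also have "2 / (E - 9 / 4) = - (2 / (9 / 4 - E))"
    by (simp add: minus_divide_right)
  finally have "1 / (\<eta> + 1 / 2)\<^sup>2 + 1 / (\<eta> - 1 / 2)\<^sup>2 + 2 / (9 / 4 - \<eta>\<^sup>2) \<le> 0"
    by (simp add: E_def)
  then have "(cos (pi * \<eta>))\<^sup>2 / (4 * pi\<^sup>2) * (1 / (\<eta> + 1 / 2)\<^sup>2 + 1 / (\<eta> - 1 / 2)\<^sup>2 + 2 / (9 / 4 - \<eta>\<^sup>2)) \<le> 0"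
    by (intro mult_nonneg_nonpos) auto
  then show ?thesis
    using assms False by (simp add: kern_coeff_eq)
qed

text \<open>
  The quadratic decay makes the cosine coefficients of the dilated kernel summable.
\<close>
lemma abs_kern_coeff_le:
  assumes "\<eta> \<ge> 2"
  shows "\<bar>kern_coeff \<eta>\<bar> \<le> 3 / \<eta>\<^sup>2"
proof -
  have E: "\<eta>\<^sup>2 \<ge> 4"
    using assms power_mono [of 2 \<eta> 2] by simp
  have "kern_coeff \<eta> \<ge> - (3 / \<eta>\<^sup>2)"
  proof -
    have "2 / (\<eta>\<^sup>2 - 9 / 4) \<le> 36 / \<eta>\<^sup>2"
      using E by (simp add: divide_le_eq le_divide_eq)
    moreover have "2 / (\<eta>\<^sup>2 - 9 / 4) = - (2 / (9 / 4 - \<eta>\<^sup>2))"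
      by (simp add: minus_divide_right)
    ultimately have "- (36 / \<eta>\<^sup>2) \<le> 1 / (\<eta> + 1 / 2)\<^sup>2 + 1 / (\<eta> - 1 / 2)\<^sup>2 + 2 / (9 / 4 - \<eta>\<^sup>2)"
      using zero_le_power2 [of "1 / (\<eta> + 1 / 2)"] zero_le_power2 [of "1 / (\<eta> - 1 / 2)"]
      unfolding power_one_over by linarith
    then have "(cos (pi * \<eta>))\<^sup>2 / (4 * pi\<^sup>2) * - (36 / \<eta>\<^sup>2) \<le> (cos (pi * \<eta>))\<^sup>2 / (4 * pi\<^sup>2)
        * (1 / (\<eta> + 1 / 2)\<^sup>2 + 1 / (\<eta> - 1 / 2)\<^sup>2 + 2 / (9 / 4 - \<eta>\<^sup>2))"
      by (rule mult_left_mono) simp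
    then have "(cos (pi * \<eta>))\<^sup>2 / (4 * pi\<^sup>2) * - (36 / \<eta>\<^sup>2) \<le> kern_coeff \<eta>"
      using assms by (subst kern_coeff_eq) auto
    moreover have "(cos (pi * \<eta>))\<^sup>2 / (4 * pi\<^sup>2) * (36 / \<eta>\<^sup>2) \<le> 1 / 12 * (36 / \<eta>\<^sup>2)"
    proof (intro mult_right_mono)
      have "4 \<le> pi\<^sup>2"
        using power_mono [of 2 pi 2] pi_ge_two by simp
      moreover have "(cos (pi * \<eta>))\<^sup>2 \<le> 1"
        by (simp add: abs_square_le_1)
      ultimately have "12 * (cos (pi * \<eta>))\<^sup>2 \<le> 4 * pi\<^sup>2"
        by linarith
      then show "(cos (pi * \<eta>))\<^sup>2 / (4 * pi\<^sup>2) \<le> 1 / 12"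
        by (simp add: field_simps)
    qed (use E in auto)
    ultimately show ?thesis by simp
  qed
  moreover have "kern_coeff \<eta> \<le> 0"
    using assms by (intro kern_coeff_nonpos) auto
  ultimately show ?thesis by simp
qed

section \<open>The wrap-around distance\<close>

lemma wrap_dist_le: "wrap_dist y y' \<le> \<bar>y - y' - of_int k\<bar>"
  unfolding wrap_dist_def by (intro cINF_lower bdd_belowI [of _ 0]) auto

lemma wrap_dist_eq_min:
  assumes "\<bar>y - y'\<bar> \<le> 1"
  shows "wrap_dist y y' = min \<bar>y - y'\<bar> (1 - \<bar>y - y'\<bar>)"
proof (rule antisym)
  show "wrap_dist y y' \<le> min \<bar>y - y'\<bar> (1 - \<bar>y - y'\<bar>)"
    using wrap_dist_le [of y y' 0] wrap_dist_le [of y y' 1] wrap_dist_le [of y y' "-1"] assms by auto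
  show "min \<bar>y - y'\<bar> (1 - \<bar>y - y'\<bar>) \<le> wrap_dist y y'"
    unfolding wrap_dist_def
  proof (rule cINF_greatest)
    fix k :: int
    show "min \<bar>y - y'\<bar> (1 - \<bar>y - y'\<bar>) \<le> \<bar>y - y' - of_int k\<bar>"
    proof (cases "k = 0")
      case False
      then have "1 \<le> \<bar>real_of_int k\<bar>"
        by linarith
      then show ?thesis by linarith
    qed simp
  qed simp
qed

lemma wrap_dist_nonneg: "0 \<le> wrap_dist y y'"
  unfolding wrap_dist_def by (intro cINF_greatest) auto

lemma wrap_dist_self: "wrap_dist y y = 0"
  by (simp add: wrap_dist_eq_min)

lemma wrap_dist_le_half:
  assumes "y \<in> {0..<1}" "y' \<in> {0..<1}"
  shows "wrap_dist y y' \<le> 1 / 2"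
proof -
  have "\<bar>y - y'\<bar> \<le> 1" using assms by auto
  then show ?thesis by (simp add: wrap_dist_eq_min min_def)
qed

lemma wrap_dist_commute:
  assumes "\<bar>y - y'\<bar> \<le> 1"
  shows "wrap_dist y y' = wrap_dist y' y"
  using wrap_dist_eq_min [of y y'] wrap_dist_eq_min [of y' y] assms by (simp add: abs_minus_commute)

lemma wrap_dist_attained:
  assumes "\<bar>y - y'\<bar> \<le> 1"
  obtains k :: int where "wrap_dist y y' = \<bar>y - y' - of_int k\<bar>"
proof -
  have "wrap_dist y y' = \<bar>y - y' - of_int 0\<bar> \<or> wrap_dist y y' = \<bar>y - y' - of_int 1\<bar>
      \<or> wrap_dist y y' = \<bar>y - y' - of_int (- 1)\<bar>"
    using wrap_dist_eq_min [OF assms] assms by (simp add: min_def) linarith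
  then show ?thesis using that by blast
qed

lemma wrap_dist_triangle:
  assumes "\<bar>a - y\<bar> \<le> 1" "\<bar>b - y\<bar> \<le> 1"
  shows "wrap_dist a b \<le> wrap_dist a y + wrap_dist b y"
proof -
  obtain k where k: "wrap_dist a y = \<bar>a - y - of_int k\<bar>"
    using assms(1) by (rule wrap_dist_attained)
  obtain l where l: "wrap_dist b y = \<bar>b - y - of_int l\<bar>"
    using assms(2) by (rule wrap_dist_attained)
  show ?thesis
    using wrap_dist_le [of a b "k - l"] unfolding k l by simp
qed

lemma q_separated_singleton:
  assumes "q_separated q Y" "q > 1 / 2" "Y \<subseteq> {0..<1}" "y \<in> Y"
  shows "Y = {y}"
proof -
  have "z = y" if "z \<in> Y" for z
  proof (rule ccontr)
    assume "z \<noteq> y"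
    then have "q \<le> wrap_dist z y"
      using assms that unfolding q_separated_def by blast
    then show False
      using wrap_dist_le_half [of z y] assms(2-4) that by (meson less_le_trans not_less order_trans subsetD)
  qed
  then show ?thesis using assms by blast
qed

section \<open>The minorant inequality\<close>

definition dilated_kern :: "real \<Rightarrow> real \<Rightarrow> real" where
  "dilated_kern \<delta> t = (if t \<le> \<delta> then kern (t / \<delta>) else 0)"

lemma kern_0: "kern 0 = 1"
  by (simp add: kern_def)

lemma kern_1: "kern 1 = 0"
  using sin_npi [of 3] by (simp add: kern_def)

lemma dilated_kern_eq_0:
  assumes "\<delta> > 0" "t \<ge> \<delta>"
  shows "dilated_kern \<delta> t = 0"
  using assms by (cases "t = \<delta>") (auto simp: dilated_kern_def kern_1)

lemma continuous_dilated_kern: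
  assumes "\<delta> > 0"
  shows "continuous_on S (dilated_kern \<delta>)"
proof -
  have "dilated_kern \<delta> = (\<lambda>t. kern (min t \<delta> / \<delta>))"
    using assms by (auto simp: dilated_kern_def kern_1 fun_eq_iff min_def)
  moreover have "continuous_on S (\<lambda>t. kern (min t \<delta> / \<delta>))"
    using assms unfolding kern_def by (intro continuous_intros) auto
  ultimately show ?thesis by simp
qed

lemma dilated_kern_cosine_coeff:
  assumes "0 < \<delta>" "\<delta> \<le> 1"
  shows "((\<lambda>t. dilated_kern \<delta> t * cos (pi * real j * t)) has_integral
            \<delta> * kern_coeff (\<delta> * real j / 2)) {0..1}"
proof -
  have "((\<lambda>t. kern ((1 / \<delta>) * t) * cos (2 * pi * (\<delta> * real j / 2) * ((1 / \<delta>) * t))) has_integral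
      (1 / \<bar>1 / \<delta>\<bar>) *\<^sub>R kern_coeff (\<delta> * real j / 2)) ((\<lambda>t. t / (1 / \<delta>)) ` {0..1})"
    using assms by (intro has_integral_stretch_real kern_has_integral) auto
  moreover have "(\<lambda>t. t / (1 / \<delta>)) ` {0..1} = {0..\<delta>}"
    using assms image_mult_atLeastAtMost [of \<delta> 0 1] by (simp add: mult.commute)
  ultimately have "((\<lambda>t. kern (t / \<delta>) * cos (pi * real j * t)) has_integral
      \<delta> * kern_coeff (\<delta> * real j / 2)) {0..\<delta>}"
    using assms by (simp add: mult.assoc)
  then have "((\<lambda>t. dilated_kern \<delta> t * cos (pi * real j * t)) has_integral
      \<delta> * kern_coeff (\<delta> * real j / 2)) {0..\<delta>}"
    by (rule has_integral_eq [rotated]) (simp add: dilated_kern_def)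
  moreover have "((\<lambda>t. dilated_kern \<delta> t * cos (pi * real j * t)) has_integral 0) {\<delta>..1}"
    using assms by (intro has_integral_is_0) (simp add: dilated_kern_eq_0)
  ultimately show ?thesis
    using has_integral_combine [of 0 \<delta> 1 "\<lambda>t. dilated_kern \<delta> t * cos (pi * real j * t)"
        "\<delta> * kern_coeff (\<delta> * real j / 2)" 0] assms
    by simp
qed

text \<open>
  The cosine series on \<open>[0,1]\<close> has the half-integral frequencies \<open>j/2\<close>. Both parities are wanted,
  since \<open>k - (N-1)/2\<close> is an integer or half an odd integer depending on \<open>N\<close>.
\<close>
lemma dilated_kern_cosine_series:
  assumes \<delta>: "0 < \<delta>" "\<delta> \<le> 1" and x: "x \<in> {0..1}"
  shows "(\<lambda>j. (if j = 0 then 1 else 2) * (\<delta> * kern_coeff (\<delta> * real j / 2)) * cos (pi * real j * x))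
           sums dilated_kern \<delta> x"
proof (rule cosine_series_sums [OF continuous_dilated_kern [OF \<delta>(1)] dilated_kern_cosine_coeff [OF \<delta>] _ x])
  show "summable (\<lambda>j. \<bar>\<delta> * kern_coeff (\<delta> * real j / 2)\<bar>)"
  proof (rule summable_comparison_test')
    show "summable (\<lambda>j. 12 / \<delta> * inverse (real j ^ 2))"
      by (intro summable_mult inverse_power_summable) simp
    fix j :: nat
    (* beyond this index the frequency is at least 2 and the decay estimate applies *)
    assume "j \<ge> nat \<lceil>4 / \<delta>\<rceil>"
    then have "4 / \<delta> \<le> real j"
      by linarith
    then have j: "\<delta> * real j / 2 \<ge> 2"
      using \<delta> by (simp add: field_simps)
    have "\<bar>\<delta> * kern_coeff (\<delta> * real j / 2)\<bar> \<le> \<delta> * (3 / (\<delta> * real j / 2)\<^sup>2)"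
      using mult_left_mono [OF abs_kern_coeff_le [OF j], of \<delta>] \<delta> by (simp add: abs_mult)
    also have "\<dots> = 12 / \<delta> * inverse (real j ^ 2)"
      using \<delta> by (simp add: field_simps power2_eq_square)
    finally show "norm \<bar>\<delta> * kern_coeff (\<delta> * real j / 2)\<bar> \<le> 12 / \<delta> * inverse (real j ^ 2)"
      by simp
  qed
qed

text \<open>
  The integers \<open>j\<close> with \<open>|j| < N\<close> and \<open>j \<equiv> N-1\<close> modulo \<open>2\<close> correspond to the \<open>k < N\<close> by
  \<open>j = 2k - (N-1)\<close>. On the left, \<open>j\<close> and \<open>-j\<close> are collected in one term, whence the weight.
\<close>
lemma sum_parity_class_reflect:
  fixes g :: "nat \<Rightarrow> real"
  shows "(\<Sum>j<N. if odd (N + j) then (if j = 0 then 1 else 2) * (g ((N - 1 + j) div 2) + g ((N - 1 - j) div 2)) else 0)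
          = 2 * (\<Sum>k<N. g k)"
proof (induction N arbitrary: g rule: induct_nat_012)
  case (ge2 n)
  let ?F = "\<lambda>j. if odd (Suc (Suc n) + j) then (if j = 0 then 1 else 2)
            * (g ((Suc (Suc n) - 1 + j) div 2) + g ((Suc (Suc n) - 1 - j) div 2)) else 0"
  have "(\<Sum>j<n. ?F j)
      = (\<Sum>j<n. if odd (n + j) then (if j = 0 then 1 else 2)
            * (g (Suc ((n - 1 + j) div 2)) + g (Suc ((n - 1 - j) div 2))) else 0)"
  proof (rule sum.cong)
    fix j
    assume "j \<in> {..<n}"
    then have "(Suc (Suc n) - 1 + j) div 2 = Suc ((n - 1 + j) div 2)"
        "(Suc (Suc n) - 1 - j) div 2 = Suc ((n - 1 - j) div 2)"
      by auto
    then show "?F j = (if odd (n + j) then (if j = 0 then 1 else 2)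
            * (g (Suc ((n - 1 + j) div 2)) + g (Suc ((n - 1 - j) div 2))) else 0)"
      by simp
  qed simp
  also have "\<dots> = 2 * (\<Sum>k<n. g (Suc k))"
    by (rule ge2.IH(1))
  finally have "(\<Sum>j<n. ?F j) = 2 * (\<Sum>k<n. g (Suc k))" .
  moreover have "(\<Sum>j<Suc (Suc n). ?F j) = (\<Sum>j<n. ?F j) + 2 * (g 0 + g (Suc n))"
    by simp
  moreover have "(\<Sum>k<Suc (Suc n). g k) = g 0 + (\<Sum>k<n. g (Suc k)) + g (Suc n)"
    by (subst sum.lessThan_Suc_shift) simp
  ultimately show ?case
    by (simp only: distrib_left)
qed simp_all

lemma norm_sum_squared:
  fixes d z :: "'i \<Rightarrow> complex"
  assumes "finite I"
  shows "(cmod (\<Sum>r\<in>I. d r * z r))\<^sup>2 = (\<Sum>r\<in>I. \<Sum>s\<in>I. Re (d r * cnj (d s) * (z r * cnj (z s))))"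
proof -
  have "(cmod w)\<^sup>2 = Re (w * cnj w)" for w
    by (simp add: complex_mult_cnj cmod_power2)
  then show ?thesis
    by (simp add: sum_product mult_ac del: times_complex.sel)
qed

text \<open>
  The phases \<open>\<theta>\<close> and \<open>-\<theta>\<close> give complex conjugate factors \<open>cis(\<theta>(r) - \<theta>(s))\<close>, and their imaginary parts cancel.
\<close>
lemma quadratic_form_cos:
  assumes "finite I"
  shows "(\<Sum>r\<in>I. \<Sum>s\<in>I. Re (d r * cnj (d s)) * cos (\<theta> r - \<theta> s))
     = ((cmod (\<Sum>r\<in>I. d r * cis (\<theta> r)))\<^sup>2 + (cmod (\<Sum>r\<in>I. d r * cis (- \<theta> r)))\<^sup>2) / 2"
proof -
  have "Re (w * (cis (\<theta> r) * cnj (cis (\<theta> s)))) + Re (w * (cis (- \<theta> r) * cnj (cis (- \<theta> s))))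
      = 2 * (Re w * cos (\<theta> r - \<theta> s))" for w r s
  proof -
    have "cis (\<theta> r) * cnj (cis (\<theta> s)) = cis (\<theta> r - \<theta> s)"
        "cis (- \<theta> r) * cnj (cis (- \<theta> s)) = cis (- (\<theta> r - \<theta> s))"
      by (simp_all only: cis_cnj cis_mult) simp_all
    moreover have "Re (w * cis t) + Re (w * cis (- t)) = 2 * (Re w * cos t)" for t
      by simp
    ultimately show ?thesis by (simp only:)
  qed
  then show ?thesis
    unfolding norm_sum_squared [OF assms] sum.distrib [symmetric]
    by (simp only: sum_distrib_left [symmetric])
qed

text \<open>
  The minorant property, summed up. Frequencies of the parity of \<open>N\<close> carry the weight \<open>0\<close>; the others are
  \<open>j = 2k - (N-1)\<close> and \<open>|u(j)| = |F(k)|\<close>. Outside the window, \<open>|j| \<ge> N+1\<close> and the coefficient is not positive; there the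
  index \<open>j = N\<close> is harmless because it has the wrong parity. This is where \<open>\<delta> = 3/(N+1)\<close> rather than \<open>3/N\<close> comes from.
\<close>
lemma kern_quadratic_form_le:
  fixes c :: "'i \<Rightarrow> complex" and x :: "'i \<Rightarrow> real"
  assumes I: "finite I" and N: "N \<ge> 1" and \<delta>: "\<delta> = 3 / (real N + 1)" and J: "J \<ge> N"
    and u: "\<And>j. u j = (\<Sum>r\<in>I. c r * cis (pi * (real N - 1) * x r) * cis (pi * of_int j * x r))"
  shows "(\<Sum>j<J. (if j = 0 then 1 else 2) * (\<delta> * kern_coeff (\<delta> * real j / 2)) * (1 - (-1) ^ (N + j))
             * (((cmod (u (int j)))\<^sup>2 + (cmod (u (- int j)))\<^sup>2) / 2))
         \<le> \<delta> / 2 * (\<Sum>k<N. (cmod (\<Sum>r\<in>I. c r * cis (2 * pi * real k * x r)))\<^sup>2)"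
    (is "(\<Sum>j<J. ?T j) \<le> _")
proof -
  define g where "g k = (cmod (\<Sum>r\<in>I. c r * cis (2 * pi * real k * x r)))\<^sup>2" for k
  have \<delta>0: "\<delta> > 0" by (simp add: \<delta>)
  have term_neg: "?T j \<le> 0" if "j \<ge> N" for j
  proof (cases "odd (N + j)")
    case True
    then have "j \<ge> N + 1" using that by (cases "j = N") auto
    then have "\<delta> * real j / 2 \<ge> 3 / 2"
      by (simp add: \<delta> field_simps)
    from kern_coeff_nonpos [OF this] True \<delta>0 show ?thesis
      by (simp add: mult_nonneg_nonpos mult_nonpos_nonneg)
  qed simp
  have term_le: "?T j \<le> \<delta> / 4 * (if odd (N + j) then (if j = 0 then 1 else 2)
       * (g ((N - 1 + j) div 2) + g ((N - 1 - j) div 2)) else 0)" if "j < N" for j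
  proof (cases "odd (N + j)")
    case True
    then have ev: "even (N - 1 + j)" "even (N - 1 - j)"
      using that by presburger+
    obtain m where m: "N - 1 + j = 2 * m"
      using ev(1) by (rule evenE)
    obtain m' where m': "N - 1 - j = 2 * m'"
      using ev(2) by (rule evenE)
    have "real ((N - 1 + j) div 2) * 2 = real N - 1 + real j"
    proof -
      have "2 * real m = real N - 1 + real j"
        using arg_cong [OF m, of real] N by simp
      then show ?thesis unfolding m by simp
    qed
    moreover have "real ((N - 1 - j) div 2) * 2 = real N - 1 - real j"
    proof -
      have "2 * real m' = real N - 1 - real j"
        using arg_cong [OF m', of real] N that by simp
      then show ?thesis unfolding m' by simp
    qed
    ultimately have phase: "2 * pi * real ((N - 1 + j) div 2) * y = pi * (real N - 1) * y + pi * real j * y"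
       "2 * pi * real ((N - 1 - j) div 2) * y = pi * (real N - 1) * y - pi * real j * y" for y
      by (metis (no_types) mult.assoc mult.commute distrib_left left_diff_distrib)+
    have g: "(cmod (u (int j)))\<^sup>2 = g ((N - 1 + j) div 2)" "(cmod (u (- int j)))\<^sup>2 = g ((N - 1 - j) div 2)"
      unfolding g_def u phase by (simp_all add: mult.assoc cis_mult)
    have "\<delta> * real j / 2 < 3 / 2" "0 \<le> \<delta> * real j / 2"
      using that \<delta>0 by (auto simp: \<delta> field_simps)
    then have k: "kern_coeff (\<delta> * real j / 2) \<le> 1 / 4"
      by (intro kern_coeff_le)
    define w G where "w = (if j = 0 then 1 else 2 :: real)" and "G = g ((N - 1 + j) div 2) + g ((N - 1 - j) div 2)"
    have "\<delta> * w * G * kern_coeff (\<delta> * real j / 2) \<le> \<delta> * w * G * (1 / 4)"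
      using \<delta>0 k by (intro mult_left_mono mult_nonneg_nonneg) (auto simp: w_def G_def g_def)
    then show ?thesis
      using True unfolding g w_def [symmetric] G_def [symmetric] by (simp add: mult_ac)
  qed simp
  have "(\<Sum>j<J. ?T j) = (\<Sum>j<N. ?T j) + (\<Sum>j=N..<J. ?T j)"
    using J by (simp add: sum.atLeastLessThan_concat lessThan_atLeast0)
  also have "\<dots> \<le> (\<Sum>j<N. \<delta> / 4 * (if odd (N + j) then (if j = 0 then 1 else 2)
       * (g ((N - 1 + j) div 2) + g ((N - 1 - j) div 2)) else 0)) + 0"
    by (intro add_mono sum_mono sum_nonpos term_neg term_le) auto
  also have "\<dots> = \<delta> / 4 * (2 * (\<Sum>k<N. g k))"
    by (simp only: sum_parity_class_reflect add_0_right flip: sum_distrib_left)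
  finally show ?thesis
    by (simp add: g_def)
qed

text \<open>
  Let \<open>B(t)\<close> be the limit of the weighted sums of \<open>cos(\<pi>jt)\<close>. The cosine series at \<open>|t|\<close> and at \<open>1 - |t|\<close> differ by the signs
  \<open>(-1)\<^sup>j\<close>, so one combination of them selects a parity class, and \<open>B(t)\<close> is up to sign
  \<open>h\<close> at the scaled distance of \<open>t\<close> to the nearest integer: as \<open>\<delta> \<le> 1/2\<close>, one of the two values of \<open>h\<close> vanishes.
  Passing to the limit in \<open>kern_quadratic_form_le\<close> gives a lower bound for the sum over the window by
  a quadratic form with unit diagonal.
\<close>
lemma kern_minorant_inequality:
  fixes c :: "'i \<Rightarrow> complex" and x :: "'i \<Rightarrow> real"
  assumes I: "finite I" and N: "N \<ge> 1" and \<delta>: "\<delta> = 3 / (real N + 1)" and \<delta>_le: "\<delta> \<le> 1 / 2"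
    and x: "\<And>r. r \<in> I \<Longrightarrow> x r \<in> {0..<1}"
  shows "(\<Sum>r\<in>I. (cmod (c r))\<^sup>2)
           - (\<Sum>r\<in>I. \<Sum>s\<in>I - {r}. cmod (c r) * cmod (c s) * \<bar>dilated_kern \<delta> (wrap_dist (x r) (x s))\<bar>)
         \<le> \<delta> / 2 * (\<Sum>k<N. (cmod (\<Sum>r\<in>I. c r * cis (2 * pi * real k * x r)))\<^sup>2)"
proof -
  define d where "d r = c r * cis (pi * (real N - 1) * x r)" for r
  define u where "u j = (\<Sum>r\<in>I. c r * cis (pi * (real N - 1) * x r) * cis (pi * of_int j * x r))" for j :: int
  define w where "w j = (if j = 0 then 1 else 2) * (\<delta> * kern_coeff (\<delta> * real j / 2)) * (1 - (-1) ^ (N + j))" for j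
  define B where "B t = dilated_kern \<delta> \<bar>t\<bar> - (-1) ^ N * dilated_kern \<delta> (1 - \<bar>t\<bar>)" for t
  define R where "R = (\<Sum>r\<in>I. \<Sum>s\<in>I. Re (d r * cnj (d s)) * B (x r - x s))"
  have \<delta>0: "\<delta> > 0" by (simp add: \<delta>)
  have B_sums: "(\<lambda>j. w j * cos (pi * real j * t)) sums B t" if t: "\<bar>t\<bar> \<le> 1" for t
  proof -
    have refl: "cos (pi * real j * (1 - \<bar>t\<bar>)) = (-1) ^ j * cos (pi * real j * \<bar>t\<bar>)" for j
      by (simp add: right_diff_distrib cos_diff mult.commute [of pi])
    have "(\<lambda>j. (if j = 0 then 1 else 2) * (\<delta> * kern_coeff (\<delta> * real j / 2)) * cos (pi * real j * \<bar>t\<bar>)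
        - (-1) ^ N * ((if j = 0 then 1 else 2) * (\<delta> * kern_coeff (\<delta> * real j / 2)) * cos (pi * real j * (1 - \<bar>t\<bar>))))
       sums B t"
      unfolding B_def using t \<delta>_le \<delta>0
      by (intro sums_diff sums_mult dilated_kern_cosine_series) auto
    moreover have "(if j = 0 then 1 else 2) * (\<delta> * kern_coeff (\<delta> * real j / 2)) * cos (pi * real j * \<bar>t\<bar>)
        - (-1) ^ N * ((if j = 0 then 1 else 2) * (\<delta> * kern_coeff (\<delta> * real j / 2)) * cos (pi * real j * (1 - \<bar>t\<bar>)))
        = w j * cos (pi * real j * t)" for j
    proof -
      have "cos (pi * real j * \<bar>t\<bar>) = cos (pi * real j * t)"
        by (simp add: abs_if)
      then show ?thesis
        unfolding refl w_def by (simp add: algebra_simps power_add)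
    qed
    ultimately show ?thesis by simp
  qed
  have dist: "\<bar>x r - x s\<bar> \<le> 1" if "r \<in> I" "s \<in> I" for r s
    using x [OF that(1)] x [OF that(2)] by auto
  have "(\<lambda>J. \<Sum>j<J. w j * (((cmod (u (int j)))\<^sup>2 + (cmod (u (- int j)))\<^sup>2) / 2)) \<longlonglongrightarrow> R"
  proof -
    have "(\<lambda>j. \<Sum>r\<in>I. \<Sum>s\<in>I. Re (d r * cnj (d s)) * (w j * cos (pi * real j * (x r - x s)))) sums R"
      unfolding R_def by (intro sums_sum sums_mult B_sums dist)
    moreover have "(\<Sum>r\<in>I. \<Sum>s\<in>I. Re (d r * cnj (d s)) * (w j * cos (pi * real j * (x r - x s))))
        = w j * (((cmod (u (int j)))\<^sup>2 + (cmod (u (- int j)))\<^sup>2) / 2)" for j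
    proof -
      have "(\<Sum>r\<in>I. \<Sum>s\<in>I. Re (d r * cnj (d s)) * cos (pi * real j * x r - pi * real j * x s))
          = ((cmod (u (int j)))\<^sup>2 + (cmod (u (- int j)))\<^sup>2) / 2"
        unfolding quadratic_form_cos [OF I] u_def d_def by simp
      moreover have "(\<Sum>r\<in>I. \<Sum>s\<in>I. Re (d r * cnj (d s)) * (w j * cos (pi * real j * (x r - x s))))
          = w j * (\<Sum>r\<in>I. \<Sum>s\<in>I. Re (d r * cnj (d s)) * cos (pi * real j * x r - pi * real j * x s))"
        unfolding sum_distrib_left right_diff_distrib by (simp only: mult_ac)
      ultimately show ?thesis by simp
    qed
    ultimately show ?thesis
      unfolding sums_def by (simp only:)
  qed
  then have "R \<le> \<delta> / 2 * (\<Sum>k<N. (cmod (\<Sum>r\<in>I. c r * cis (2 * pi * real k * x r)))\<^sup>2)"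
  proof (rule LIMSEQ_le_const2, intro exI [of _ N] allI impI)
    fix J
    assume "N \<le> J"
    from kern_quadratic_form_le [OF I N \<delta> this u_def]
    show "(\<Sum>j<J. w j * (((cmod (u (int j)))\<^sup>2 + (cmod (u (- int j)))\<^sup>2) / 2))
       \<le> \<delta> / 2 * (\<Sum>k<N. (cmod (\<Sum>r\<in>I. c r * cis (2 * pi * real k * x r)))\<^sup>2)"
      unfolding w_def .
  qed
  moreover have "(\<Sum>r\<in>I. (cmod (c r))\<^sup>2)
      - (\<Sum>r\<in>I. \<Sum>s\<in>I - {r}. cmod (c r) * cmod (c s) * \<bar>dilated_kern \<delta> (wrap_dist (x r) (x s))\<bar>) \<le> R"
  proof -
    have "(cmod (c r))\<^sup>2 - (\<Sum>s\<in>I - {r}. cmod (c r) * cmod (c s) * \<bar>dilated_kern \<delta> (wrap_dist (x r) (x s))\<bar>)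
        \<le> (\<Sum>s\<in>I. Re (d r * cnj (d s)) * B (x r - x s))" if r: "r \<in> I" for r
    proof -
      have "B 0 = 1"
        using \<delta>0 \<delta>_le dilated_kern_eq_0 [of \<delta> 1] by (simp add: B_def dilated_kern_def kern_0)
      moreover have "Re (d r * cnj (d r)) = (cmod (c r))\<^sup>2"
      proof -
        have "Re (d r * cnj (d r)) = (cmod (d r))\<^sup>2"
          by (simp add: complex_mult_cnj cmod_power2 del: times_complex.sel)
        then show ?thesis
          by (simp only: d_def norm_mult norm_cis mult_1_right)
      qed
      moreover have "- (cmod (c r) * cmod (c s) * \<bar>dilated_kern \<delta> (wrap_dist (x r) (x s))\<bar>)
          \<le> Re (d r * cnj (d s)) * B (x r - x s)" if s: "s \<in> I" for s
      proof -
        define t where "t = x r - x s"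
        have "\<bar>B t\<bar> = \<bar>dilated_kern \<delta> (min \<bar>t\<bar> (1 - \<bar>t\<bar>))\<bar>"
          using dilated_kern_eq_0 [of \<delta> "\<bar>t\<bar>"] dilated_kern_eq_0 [of \<delta> "1 - \<bar>t\<bar>"] \<delta>0 \<delta>_le
          by (auto simp: B_def abs_mult power_abs min_def)
        then have "\<bar>B t\<bar> = \<bar>dilated_kern \<delta> (wrap_dist (x r) (x s))\<bar>"
          using dist [OF r s] by (simp add: t_def wrap_dist_eq_min)
        moreover have "\<bar>Re (d r * cnj (d s))\<bar> \<le> cmod (c r) * cmod (c s)"
          using abs_Re_le_cmod [of "d r * cnj (d s)"] by (simp add: d_def norm_mult)
        ultimately have "\<bar>Re (d r * cnj (d s)) * B t\<bar> \<le> cmod (c r) * cmod (c s) * \<bar>dilated_kern \<delta> (wrap_dist (x r) (x s))\<bar>"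
          unfolding abs_mult by (metis abs_ge_zero mult_right_mono)
        then show ?thesis
          unfolding t_def by linarith
      qed
      then have "(\<Sum>s\<in>I - {r}. - (cmod (c r) * cmod (c s) * \<bar>dilated_kern \<delta> (wrap_dist (x r) (x s))\<bar>))
          \<le> (\<Sum>s\<in>I - {r}. Re (d r * cnj (d s)) * B (x r - x s))"
        by (intro sum_mono) auto
      ultimately show ?thesis
        using sum.remove [OF I r, of "\<lambda>s. Re (d r * cnj (d s)) * B (x r - x s)"]
        by (simp add: sum_negf)
    qed
    then show ?thesis
      unfolding R_def by (simp add: sum_mono flip: sum_subtractf)
  qed
  ultimately show ?thesis by linarith
qed

section \<open>The kernel at close nodes\<close>

lemma x_cos_x_le_sin_x:
  assumes "0 \<le> x" "x \<le> pi"
  shows "x * cos x \<le> sin (x::real)"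
proof -
  have "sin 0 - 0 * cos 0 \<le> sin x - x * cos x"
  proof (rule DERIV_nonneg_imp_nondecreasing [OF assms(1)])
    fix t
    assume "0 \<le> t" "t \<le> x"
    then show "\<exists>y. ((\<lambda>t. sin t - t * cos t) has_real_derivative y) (at t) \<and> 0 \<le> y"
      using assms
      by (intro exI [of _ "t * sin t"] conjI mult_nonneg_nonneg sin_ge_zero)
         (auto intro!: derivative_eq_intros)
  qed
  then show ?thesis by simp
qed

lemma pi_ge_3: "pi \<ge> 3"
  using sin_x_le_x [of "pi / 6"] by (simp add: sin_30)

lemma pi_squared_le_12: "pi\<^sup>2 \<le> 12"
proof -
  have "pi / 6 * (sqrt 3 / 2) \<le> 1 / 2"
    using x_cos_x_le_sin_x [of "pi / 6"] by (simp add: sin_30 cos_30)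
  then have "(pi * sqrt 3)\<^sup>2 \<le> 6\<^sup>2"
    by (intro power_mono) auto
  then show ?thesis by (simp add: power_mult_distrib)
qed

lemma three_eighths_x_le_sin_x:
  assumes "0 \<le> x" "x \<le> pi / 2"
  shows "3 / 8 * x \<le> sin x"
proof (cases "x \<le> pi / 3")
  case True
  then have "1 / 2 \<le> cos x"
    using cos_monotone_0_pi_le [of x "pi / 3"] assms by (simp add: cos_60)
  then have "3 / 8 * x \<le> x * cos x"
    using assms mult_left_mono [of "3 / 8" "cos x" x] by simp
  also have "\<dots> \<le> sin x"
    using assms by (intro x_cos_x_le_sin_x) auto
  finally show ?thesis .
next
  case False
  then have "sqrt 3 / 2 \<le> sin x"
    using sin_monotone_2pi_le [of "pi / 3" x] assms by (simp add: sin_60)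
  moreover have "3 / 2 \<le> sqrt 3"
    by (rule real_le_rsqrt) (simp add: power2_eq_square)
  moreover have "x \<le> 2"
    using assms pi_half_less_two by linarith
  ultimately show ?thesis by linarith
qed

lemma one_minus_cos_ge:
  assumes "0 \<le> x" "x \<le> pi / 2"
  shows "x\<^sup>2 / 4 \<le> 1 - cos x"
proof -
  have "0 \<le> cos x"
    using assms by (intro cos_ge_zero) auto
  then have "1 / 2 \<le> (cos (x / 2))\<^sup>2"
    using cos_double_cos [of "x / 2"] by simp
  then have "(x / 2)\<^sup>2 * (1 / 2) \<le> (x / 2)\<^sup>2 * (cos (x / 2))\<^sup>2"
    by (intro mult_left_mono) auto
  also have "\<dots> \<le> (sin (x / 2))\<^sup>2"
    unfolding power_mult_distrib [symmetric]
    using assms by (intro power_mono x_cos_x_le_sin_x mult_nonneg_nonneg cos_ge_zero) auto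
  also have "\<dots> = (1 - cos x) / 2"
    using cos_double_sin [of "x / 2"] by simp
  finally show ?thesis
    by (simp add: power_divide)
qed

lemma sin_treble: "sin (3 * x) = 3 * sin x - 4 * sin x ^ 3" for x :: real
proof -
  have "sin (3 * x) = sin (2 * x + x)" by simp
  also have "\<dots> = 2 * sin x * (cos x)\<^sup>2 + (1 - 2 * (sin x)\<^sup>2) * sin x"
    by (simp only: sin_add sin_double cos_double_sin) (simp add: power2_eq_square)
  also have "\<dots> = 3 * sin x - 4 * sin x ^ 3"
    by (simp only: cos_squared_eq) (simp add: algebra_simps power2_eq_square power3_eq_cube)
  finally show ?thesis .
qed

lemma kern_alt: "kern t = (1 - t) * cos (pi * t) + (sin (pi * t) - 4 / 3 * sin (pi * t) ^ 3) / pi"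
  using sin_treble [of "pi * t"] by (simp add: kern_def field_simps)

text \<open>
  With \<open>\<theta> = \<pi>w\<close> one has \<open>\<pi>h(1-w) = (sin \<theta> - \<theta> cos \<theta>) - (4/3) sin\<^sup>3 \<theta>\<close>, and
  both terms are of third order: \<open>sin \<theta> - \<theta> cos \<theta> \<le> \<theta>(1 - cos \<theta>) \<le> \<theta> sin\<^sup>2 \<theta>\<close>.
\<close>
lemma abs_kern_near_one:
  assumes "0 \<le> w" "w \<le> 1 / 2"
  shows "\<bar>kern (1 - w)\<bar> \<le> 4 * sin (pi * w) ^ 3 / (3 * pi)"
proof -
  define \<theta> where "\<theta> = pi * w"
  have \<theta>: "0 \<le> \<theta>" "\<theta> \<le> pi / 2" using assms by (auto simp: \<theta>_def)
  define k where "k = sin \<theta> - \<theta> * cos \<theta>"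
  have s: "0 \<le> sin \<theta>" and c: "0 \<le> cos \<theta>"
    using \<theta> by (auto intro!: sin_ge_zero cos_ge_zero)
  have "kern (1 - w) = (k - 4 / 3 * sin \<theta> ^ 3) / pi"
    by (simp add: kern_alt right_diff_distrib sin_diff cos_diff k_def field_simps flip: \<theta>_def)
  moreover have "0 \<le> k"
    using x_cos_x_le_sin_x [of \<theta>] \<theta> by (simp add: k_def)
  moreover have "k \<le> 8 / 3 * sin \<theta> ^ 3"
  proof -
    have "k \<le> \<theta> * (1 - cos \<theta>)"
      using sin_x_le_x [OF \<theta>(1)] by (simp add: k_def algebra_simps)
    also have "\<dots> \<le> (8 / 3 * sin \<theta>) * (sin \<theta>)\<^sup>2"
    proof (rule mult_mono)
      show "\<theta> \<le> 8 / 3 * sin \<theta>"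
        using three_eighths_x_le_sin_x [OF \<theta>] by simp
      have "(cos \<theta>)\<^sup>2 \<le> cos \<theta>"
        using mult_left_mono [OF cos_le_one c] by (simp add: power2_eq_square)
      then show "1 - cos \<theta> \<le> (sin \<theta>)\<^sup>2"
        by (simp add: sin_squared_eq)
    qed (use s in auto)
    finally show ?thesis
      by (simp add: power2_eq_square power3_eq_cube)
  qed
  ultimately show ?thesis
    by (simp add: abs_le_iff field_simps flip: \<theta>_def)
qed

text \<open>
  Let \<open>A = (1 + cos(\<pi>u))/2\<close> and \<open>B = 4 sin\<^sup>3(\<pi>u)/(3\<pi>)\<close>. Then \<open>|h(1-w)| \<le> B\<close> and \<open>h(u) \<le> A - B\<close>, and \<open>B \<le> A\<close> gives
  \<open>(A-B)\<^sup>2 + B\<^sup>2 \<le> A\<^sup>2\<close>. If \<open>h(u)\<close> is negative, it is so small that crude bounds suffice.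
\<close>
lemma kern_squares_le:
  assumes "0 \<le> w" "w \<le> u" "u \<le> 1 / 2"
  shows "(kern u)\<^sup>2 + (kern (1 - w))\<^sup>2 \<le> ((1 + cos (pi * u)) / 2)\<^sup>2"
proof -
  define s c A B where "s = sin (pi * u)" and "c = cos (pi * u)" and "A = (1 + c) / 2" and "B = 4 * s ^ 3 / (3 * pi)"
  have u: "0 \<le> pi * u" "pi * u \<le> pi / 2" "- (pi / 2) \<le> pi * u" "pi * u \<le> pi"
    using assms by (auto intro: order_trans [of "- (pi / 2)" 0])
  then have s0: "0 \<le> s" and c0: "0 \<le> c" and s1: "s \<le> 1" and c1: "c \<le> 1"
    unfolding s_def c_def by (blast intro: sin_ge_zero cos_ge_zero sin_le_one cos_le_one)+
  have w: "\<bar>kern (1 - w)\<bar> \<le> B"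
  proof -
    have w': "0 \<le> pi * w" "pi * w \<le> pi * u"
      using assms by auto
    have "0 \<le> sin (pi * w)"
      using w' u by (intro sin_ge_zero) linarith+
    moreover have "sin (pi * w) \<le> s"
      unfolding s_def using w' u pi_ge_zero by (intro sin_monotone_2pi_le) linarith+
    ultimately have "4 * sin (pi * w) ^ 3 / (3 * pi) \<le> B"
      unfolding B_def by (intro divide_right_mono mult_left_mono power_mono) auto
    then show ?thesis
      using abs_kern_near_one [of w] assms by simp
  qed
  have B0: "0 \<le> B" using s0 by (simp add: B_def)
  have B: "B \<le> 4 / 9"
  proof -
    have "B \<le> 4 * 1 / (3 * 3)"
      unfolding B_def using s0 s1 pi_ge_3 by (intro frac_le mult_left_mono power_le_one) auto
    then show ?thesis by simp
  qed
  have "(kern u)\<^sup>2 + B\<^sup>2 \<le> A\<^sup>2"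
  proof (cases "kern u \<ge> 0")
    case True
    have "s \<le> pi * u"
      unfolding s_def using assms by (intro sin_x_le_x) auto
    then have "s / pi \<le> u"
      by (simp add: field_simps)
    moreover have "kern u = (1 - u) * c + s / pi - B"
      by (simp add: kern_alt s_def c_def B_def diff_divide_distrib)
    moreover have "u * (1 - c) \<le> 1 / 2 * (1 - c)"
      using assms c1 by (intro mult_right_mono) auto
    ultimately have "kern u \<le> A - B"
      by (simp add: A_def algebra_simps)
    then have "(kern u)\<^sup>2 \<le> (A - B)\<^sup>2"
      using True by (intro power_mono)
    moreover have "B * B \<le> B * A"
      using B B0 c0 by (intro mult_left_mono) (auto simp: A_def)
    ultimately show ?thesis
      by (simp add: power2_eq_square algebra_simps)
  next
    case False
    have "- 1 / 9 \<le> - 1 / (3 * pi)"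
      using pi_ge_3 by (simp add: field_simps)
    also have "\<dots> \<le> sin (3 * (pi * u)) / (3 * pi)"
      by (intro divide_right_mono) auto
    also have "\<dots> \<le> kern u"
      using assms c0 by (simp add: kern_def c_def mult.assoc)
    finally have "\<bar>kern u\<bar> \<le> 1 / 9"
      using False by simp
    then have "(kern u)\<^sup>2 \<le> (1 / 9)\<^sup>2"
      by (metis abs_ge_zero power2_abs power_mono)
    moreover have "B\<^sup>2 \<le> (4 / 9)\<^sup>2"
      using B B0 by (intro power_mono)
    moreover have "(1 / 2)\<^sup>2 \<le> A\<^sup>2"
      using c0 by (intro power_mono) (auto simp: A_def)
    ultimately show ?thesis
      by (simp add: power2_eq_square)
  qed
  moreover have "(kern (1 - w))\<^sup>2 \<le> B\<^sup>2"
    using w by (metis abs_ge_zero power2_abs power_mono)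
  ultimately show ?thesis
    by (simp add: A_def c_def)
qed

text \<open>
  If the smaller of \<open>u\<close> and \<open>v\<close> is at most \<open>1/2\<close>, then \<open>kern_squares_le\<close> applies and \<open>cos(\<pi>u)\<close> provides the
  quadratic gain. Otherwise both values of \<open>h\<close> are at most \<open>4/9\<close>, whereas the right-hand side is at least \<open>(2/3)\<^sup>2\<close>.
\<close>
lemma kern_pair_bound:
  assumes x: "0 \<le> x" "x \<le> u" "x \<le> v" "u \<le> 1" "v \<le> 1" and sum: "u + v \<ge> 1"
  shows "(kern u)\<^sup>2 + (kern v)\<^sup>2 \<le> (1 - (pi * x / 6)\<^sup>2)\<^sup>2"
  using x sum
proof (induction u v rule: linorder_wlog)
  case (le u v)
  have eps: "(pi * t / 6)\<^sup>2 \<le> 1 / 3" if "0 \<le> t" "t \<le> 1" for t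
  proof -
    have "pi\<^sup>2 * t\<^sup>2 \<le> 12 * 1"
      using that pi_squared_le_12 by (intro mult_mono power_le_one) auto
    then show ?thesis
      by (simp add: power_divide power_mult_distrib)
  qed
  show ?case
  proof (cases "u \<le> 1 / 2")
    case True
    define \<theta> where "\<theta> = pi * u"
    have \<theta>: "0 \<le> \<theta>" "\<theta> \<le> pi / 2" using True le by (auto simp: \<theta>_def)
    have "(kern u)\<^sup>2 + (kern (1 - (1 - v)))\<^sup>2 \<le> ((1 + cos \<theta>) / 2)\<^sup>2"
      unfolding \<theta>_def using le True by (intro kern_squares_le) auto
    also have "\<dots> \<le> (1 - (pi * x / 6)\<^sup>2)\<^sup>2"
    proof (intro power_mono)
      have "\<theta>\<^sup>2 / 4 \<le> 1 - cos \<theta>"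
        using \<theta> by (rule one_minus_cos_ge)
      moreover have "(pi * x)\<^sup>2 \<le> \<theta>\<^sup>2"
        unfolding \<theta>_def using le by (intro power_mono mult_left_mono) auto
      moreover have "(pi * x / 6)\<^sup>2 = (pi * x)\<^sup>2 / 36"
        by (simp add: power_divide)
      ultimately show "(1 + cos \<theta>) / 2 \<le> 1 - (pi * x / 6)\<^sup>2"
        using zero_le_power2 [of \<theta>] by argo
      show "0 \<le> (1 + cos \<theta>) / 2" using cos_ge_minus_one [of \<theta>] by argo
    qed
    finally show ?thesis by simp
  next
    case False
    have small: "(kern t)\<^sup>2 \<le> (4 / 9)\<^sup>2" if "1 / 2 \<le> t" "t \<le> 1" for t
    proof -
      have "0 \<le> sin (pi * (1 - t))"
        using that by (intro sin_ge_zero) (auto intro!: mult_left_le)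
      then have "4 * sin (pi * (1 - t)) ^ 3 / (3 * pi) \<le> 4 * 1 / (3 * 3)"
        using pi_ge_3 by (intro frac_le mult_left_mono power_le_one) auto
      then have "\<bar>kern t\<bar> \<le> 4 / 9"
        using abs_kern_near_one [of "1 - t"] that by simp
      then show ?thesis
        by (metis abs_ge_zero power2_abs power_mono)
    qed
    have "(2 / 3)\<^sup>2 \<le> (1 - (pi * x / 6)\<^sup>2)\<^sup>2"
      using eps [of x] le by (intro power_mono) auto
    then show ?thesis
      using small [of u] small [of v] le False by (simp add: power2_eq_square)
  qed
next
  case (sym u v)
  then show ?case by (simp add: add.commute)
qed

text \<open>
  Two points of \<open>Y\<close> on the same side of \<open>y'\<close> and within \<open>\<delta>\<close> of it would be less than \<open>\<delta>\<close> apart. So at most one point on each side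
  contributes (the sets \<open>P\<close> and \<open>M\<close>), and the triangle inequality yields the hypothesis \<open>u + v \<ge> 1\<close> of \<open>kern_pair_bound\<close>.
  A single point is paired with the value \<open>h(1) = 0\<close>.
\<close>
lemma sum_dilated_kern_squares_le:
  assumes Y: "finite Y" "Y \<subseteq> {0..<1}" and y': "y' \<in> {0..<1}"
    and sep: "q_separated q Y" and \<delta>: "0 < \<delta>" "\<delta> \<le> q"
    and \<tau>: "0 \<le> \<tau>" "\<tau> \<le> \<delta>" "\<And>y. y \<in> Y \<Longrightarrow> \<tau> \<le> wrap_dist y y'"
  shows "(\<Sum>y\<in>Y. (dilated_kern \<delta> (wrap_dist y y'))\<^sup>2) \<le> (1 - (pi * (\<tau> / \<delta>) / 6)\<^sup>2)\<^sup>2"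
proof -
  let ?f = "\<lambda>y. (dilated_kern \<delta> (wrap_dist y y'))\<^sup>2"
  define Z where "Z = {y\<in>Y. wrap_dist y y' < \<delta>}"
  define P where "P = {y\<in>Y. \<exists>k::int. 0 \<le> y - y' - of_int k \<and> y - y' - of_int k < \<delta>}"
  define M where "M = {y\<in>Y. \<exists>k::int. - \<delta> < y - y' - of_int k \<and> y - y' - of_int k < 0}"
  have close: "\<bar>y - y'\<bar> \<le> 1" if "y \<in> Y" for y
    using that Y(2) y' by (auto simp: abs_le_iff subset_iff intro: less_imp_le)
  have eq: "a = b" if "a \<in> Y" "b \<in> Y" "\<bar>a - b - of_int k\<bar> < \<delta>" for a b and k :: int
    using sep that wrap_dist_le [of a b k] \<delta> unfolding q_separated_def by (meson le_less_trans not_less order_trans)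
  have P: "a = b" if "a \<in> P" "b \<in> P" for a b
  proof -
    from that obtain k l :: int where "0 \<le> a - y' - of_int k" "a - y' - of_int k < \<delta>"
        "0 \<le> b - y' - of_int l" "b - y' - of_int l < \<delta>"
      unfolding P_def by blast
    then have "\<bar>a - b - of_int (k - l)\<bar> < \<delta>" by (simp add: abs_less_iff)
    then show ?thesis using eq that unfolding P_def by blast
  qed
  have M: "a = b" if "a \<in> M" "b \<in> M" for a b
  proof -
    from that obtain k l :: int where "- \<delta> < a - y' - of_int k" "a - y' - of_int k < 0"
        "- \<delta> < b - y' - of_int l" "b - y' - of_int l < 0"
      unfolding M_def by blast
    then have "\<bar>a - b - of_int (k - l)\<bar> < \<delta>" by (simp add: abs_less_iff)
    then show ?thesis using eq that unfolding M_def by blast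
  qed
  have Z: "Z \<subseteq> P \<union> M"
  proof
    fix y
    assume "y \<in> Z"
    then have y: "y \<in> Y" "wrap_dist y y' < \<delta>" by (auto simp: Z_def)
    from wrap_dist_attained [OF close [OF y(1)]] obtain k where "wrap_dist y y' = \<bar>y - y' - of_int k\<bar>" .
    with y have "\<bar>y - y' - of_int k\<bar> < \<delta>" by simp
    then have "0 \<le> y - y' - of_int k \<and> y - y' - of_int k < \<delta> \<or> - \<delta> < y - y' - of_int k \<and> y - y' - of_int k < 0"
      by linarith
    with y(1) show "y \<in> P \<union> M"
      unfolding P_def M_def by blast
  qed
  have fz: "?f y = (kern (wrap_dist y y' / \<delta>))\<^sup>2" if "y \<in> Z" for y
    using that by (simp add: Z_def dilated_kern_def)
  have dz: "\<tau> / \<delta> \<le> wrap_dist y y' / \<delta>" "wrap_dist y y' / \<delta> \<le> 1" if "y \<in> Z" for y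
    using that \<tau> \<delta> by (auto simp: Z_def intro: divide_right_mono)
  have "(\<Sum>y\<in>Y. ?f y) = (\<Sum>y\<in>Z. ?f y)"
    using Y dilated_kern_eq_0 [OF \<delta>(1)] by (intro sum.mono_neutral_right) (auto simp: Z_def not_less)
  also have "\<dots> \<le> (1 - (pi * (\<tau> / \<delta>) / 6)\<^sup>2)\<^sup>2"
  proof (cases "\<exists>a\<in>Z. \<exists>b\<in>Z. a \<noteq> b")
    case True
    then obtain a b where ab: "a \<in> Z" "b \<in> Z" "a \<noteq> b" by blast
    then have "Z = {a, b}"
      using Z P M by blast
    moreover have "(kern (wrap_dist a y' / \<delta>))\<^sup>2 + (kern (wrap_dist b y' / \<delta>))\<^sup>2 \<le> (1 - (pi * (\<tau> / \<delta>) / 6)\<^sup>2)\<^sup>2"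
    proof (rule kern_pair_bound)
      have "\<delta> \<le> wrap_dist a b"
        using sep ab \<delta> unfolding q_separated_def Z_def by force
      also have "\<dots> \<le> wrap_dist a y' + wrap_dist b y'"
        using ab close by (intro wrap_dist_triangle) (auto simp: Z_def)
      finally show "1 \<le> wrap_dist a y' / \<delta> + wrap_dist b y' / \<delta>"
        using \<delta> by (simp add: field_simps)
    qed (use ab dz \<tau> \<delta> in auto)
    ultimately show ?thesis
      using ab fz by simp
  next
    case False
    show ?thesis
    proof (cases "Z = {}")
      case False
      then obtain a where a: "a \<in> Z" by blast
      with \<open>\<not> (\<exists>a\<in>Z. \<exists>b\<in>Z. a \<noteq> b)\<close> have "Z = {a}" by blast
      moreover have "0 \<le> wrap_dist a y' / \<delta>"
        using dz(1) [OF a] \<tau>(1) \<delta>(1) by (meson divide_nonneg_pos order_trans)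
      then have "(kern (wrap_dist a y' / \<delta>))\<^sup>2 + (kern 1)\<^sup>2 \<le> (1 - (pi * (\<tau> / \<delta>) / 6)\<^sup>2)\<^sup>2"
        using a dz [OF a] \<tau> \<delta> by (intro kern_pair_bound) auto
      ultimately show ?thesis
        using a fz by (simp add: kern_1)
    qed simp
  qed
  finally show ?thesis .
qed

section \<open>Lower bounds for exponential sums\<close>

text \<open>
  Where \<open>H\<close> does not vanish, \<open>2abH \<le> Ka\<^sup>2 + b\<^sup>2H\<^sup>2/K\<close>. The first summand is charged at most once to every row, and
  the second is summed along the columns.
\<close>
lemma bilinear_form_le:
  fixes a :: "'a \<Rightarrow> real" and b :: "'b \<Rightarrow> real" and H :: "'a \<Rightarrow> 'b \<Rightarrow> real"
  assumes fin: "finite Y" "finite Y'" and K: "K > 0"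
    and row: "\<And>y. y \<in> Y \<Longrightarrow> \<exists>\<^sub>\<le>\<^sub>1 y'. y' \<in> Y' \<and> H y y' \<noteq> 0"
    and col: "\<And>y'. y' \<in> Y' \<Longrightarrow> (\<Sum>y\<in>Y. (H y y')\<^sup>2) \<le> K\<^sup>2"
  shows "(\<Sum>y\<in>Y. \<Sum>y'\<in>Y'. 2 * (a y * b y' * H y y')) \<le> K * ((\<Sum>y\<in>Y. (a y)\<^sup>2) + (\<Sum>y'\<in>Y'. (b y')\<^sup>2))"
proof -
  have "(\<Sum>y\<in>Y. \<Sum>y'\<in>Y'. 2 * (a y * b y' * H y y'))
      \<le> (\<Sum>y\<in>Y. \<Sum>y'\<in>Y'. K * (a y)\<^sup>2 * (if H y y' \<noteq> 0 then 1 else 0) + (b y')\<^sup>2 / K * (H y y')\<^sup>2)"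
  proof (intro sum_mono)
    fix y y'
    have "0 \<le> (K * a y - b y' * H y y')\<^sup>2 / K"
      using K by simp
    also have "\<dots> = K * (a y)\<^sup>2 + (b y')\<^sup>2 / K * (H y y')\<^sup>2 - 2 * (a y * b y' * H y y')"
      using K by (simp add: field_simps power2_eq_square)
    finally show "2 * (a y * b y' * H y y') \<le> K * (a y)\<^sup>2 * (if H y y' \<noteq> 0 then 1 else 0) + (b y')\<^sup>2 / K * (H y y')\<^sup>2"
      by auto
  qed
  also have "\<dots> = (\<Sum>y\<in>Y. K * (a y)\<^sup>2 * (\<Sum>y'\<in>Y'. if H y y' \<noteq> 0 then 1 else 0))
      + (\<Sum>y'\<in>Y'. (b y')\<^sup>2 / K * (\<Sum>y\<in>Y. (H y y')\<^sup>2))"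
    using sum.swap [of "\<lambda>y y'. (b y')\<^sup>2 / K * (H y y')\<^sup>2" Y' Y]
    by (simp only: sum.distrib sum_distrib_left)
  also have "\<dots> \<le> (\<Sum>y\<in>Y. K * (a y)\<^sup>2 * 1) + (\<Sum>y'\<in>Y'. (b y')\<^sup>2 / K * K\<^sup>2)"
  proof (intro add_mono sum_mono mult_left_mono col)
    fix y
    assume y: "y \<in> Y"
    have "card {y' \<in> Y'. H y y' \<noteq> 0} \<le> 1"
      using row [OF y] fin by (auto simp: card_le_Suc0_iff_eq Uniq_def)
    then show "(\<Sum>y'\<in>Y'. if H y y' \<noteq> 0 then 1 else 0) \<le> (1 :: real)"
      using fin by (simp add: sum.If_cases Int_def)
  qed (use K in auto)
  also have "\<dots> = K * ((\<Sum>y\<in>Y. (a y)\<^sup>2) + (\<Sum>y'\<in>Y'. (b y')\<^sup>2))"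
    using K by (simp add: sum_distrib_left distrib_left power2_eq_square mult.commute)
  finally show ?thesis .
qed

lemma separated_lower_bound:
  fixes c :: "real \<Rightarrow> complex"
  assumes N: "N \<ge> 1" and \<delta>: "3 / (real N + 1) \<le> 1 / 2"
    and Z: "finite Z" "Z \<subseteq> {0..<1}" and sep: "q_separated (3 / (real N + 1)) Z"
  shows "2 / 3 * (real N + 1) * (\<Sum>y\<in>Z. (cmod (c y))\<^sup>2)
      \<le> (\<Sum>k<N. (cmod (\<Sum>y\<in>Z. c y * cis (2 * pi * real k * y)))\<^sup>2)"
proof -
  define \<delta> where "\<delta> = 3 / (real N + 1)"
  have "(\<Sum>r\<in>Z. \<Sum>s\<in>Z - {r}. cmod (c r) * cmod (c s) * \<bar>dilated_kern \<delta> (wrap_dist r s)\<bar>) = 0"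
    using sep by (intro sum.neutral ballI) (auto simp: q_separated_def \<delta>_def intro!: dilated_kern_eq_0)
  then have "(\<Sum>y\<in>Z. (cmod (c y))\<^sup>2) \<le> \<delta> / 2 * (\<Sum>k<N. (cmod (\<Sum>y\<in>Z. c y * cis (2 * pi * real k * y)))\<^sup>2)"
    using kern_minorant_inequality [OF Z(1) N \<delta>_def, where x = "\<lambda>y. y" and c = c] \<delta> Z(2)
    by (simp add: \<delta>_def subset_iff)
  then show ?thesis
    by (simp add: \<delta>_def field_simps)
qed

lemma clustered_lower_bound:
  fixes c :: "real \<Rightarrow> complex"
  assumes N: "N \<ge> 1" and \<delta>: "3 / (real N + 1) \<le> 1 / 2" and q: "3 / (real N + 1) \<le> q"
    and Y: "finite Y" "Y \<subseteq> {0..<1}" "q_separated q Y"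
    and Y': "finite Y'" "Y' \<subseteq> {0..<1}" "q_separated q Y'"
    and disj: "Y \<inter> Y' = {}"
    and one: "\<forall>y\<in>Y. \<exists>\<^sub>\<le>\<^sub>1 y'. y' \<in> Y' \<and> wrap_dist y y' < q"
    and \<tau>: "0 \<le> \<tau>" "\<tau> \<le> 3 / (real N + 1)" "\<And>y y'. y \<in> Y \<Longrightarrow> y' \<in> Y' \<Longrightarrow> \<tau> \<le> wrap_dist y y'"
  shows "pi\<^sup>2 / (2 * 3 ^ 5) * (real N + 1) ^ 3 * \<tau>\<^sup>2 * (\<Sum>y\<in>Y \<union> Y'. (cmod (c y))\<^sup>2)
      \<le> (\<Sum>k<N. (cmod (\<Sum>y\<in>Y \<union> Y'. c y * cis (2 * pi * real k * y)))\<^sup>2)"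
proof -
  define \<delta> where "\<delta> = 3 / (real N + 1)"
  define \<epsilon> where "\<epsilon> = (pi * (\<tau> / \<delta>) / 6)\<^sup>2"
  define H where "H y y' = \<bar>dilated_kern \<delta> (wrap_dist y y')\<bar>" for y y'
  let ?S = "\<Sum>y\<in>Y \<union> Y'. (cmod (c y))\<^sup>2"
  let ?F = "\<Sum>k<N. (cmod (\<Sum>y\<in>Y \<union> Y'. c y * cis (2 * pi * real k * y)))\<^sup>2"
  have \<delta>0: "\<delta> > 0" by (simp add: \<delta>_def)
  have far: "H y y' = 0" if "wrap_dist y y' \<ge> q" for y y'
    using that q dilated_kern_eq_0 [OF \<delta>0] by (auto simp: H_def \<delta>_def)
  have H_commute: "H y' y = H y y'" if "y \<in> Y" "y' \<in> Y'" for y y'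
  proof -
    have "y \<in> {0..<1}" "y' \<in> {0..<1}" using that Y Y' by auto
    then have "\<bar>y - y'\<bar> \<le> 1" by auto
    then show ?thesis unfolding H_def by (simp add: wrap_dist_commute)
  qed
  have rowY: "(\<Sum>s\<in>Y \<union> Y' - {r}. cmod (c r) * cmod (c s) * H r s) = (\<Sum>s\<in>Y'. cmod (c r) * cmod (c s) * H r s)"
    if "r \<in> Y" for r
    using Y Y' that disj far by (intro sum.mono_neutral_right) (auto simp: q_separated_def)
  have rowY': "(\<Sum>s\<in>Y \<union> Y' - {r}. cmod (c r) * cmod (c s) * H r s) = (\<Sum>s\<in>Y. cmod (c r) * cmod (c s) * H r s)"
    if "r \<in> Y'" for r
    using Y Y' that disj far by (intro sum.mono_neutral_right) (auto simp: q_separated_def)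
  have "(\<Sum>r\<in>Y \<union> Y'. \<Sum>s\<in>Y \<union> Y' - {r}. cmod (c r) * cmod (c s) * H r s)
      = (\<Sum>r\<in>Y. \<Sum>s\<in>Y'. cmod (c r) * cmod (c s) * H r s) + (\<Sum>r\<in>Y'. \<Sum>s\<in>Y. cmod (c r) * cmod (c s) * H r s)"
    using Y Y' disj by (simp add: sum.union_disjoint rowY rowY')
  also have "(\<Sum>r\<in>Y'. \<Sum>s\<in>Y. cmod (c r) * cmod (c s) * H r s) = (\<Sum>r\<in>Y. \<Sum>s\<in>Y'. cmod (c r) * cmod (c s) * H r s)"
    by (subst sum.swap) (intro sum.cong refl, simp add: H_commute)
  also have "(\<Sum>r\<in>Y. \<Sum>s\<in>Y'. cmod (c r) * cmod (c s) * H r s) + (\<Sum>r\<in>Y. \<Sum>s\<in>Y'. cmod (c r) * cmod (c s) * H r s)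
      = (\<Sum>r\<in>Y. \<Sum>s\<in>Y'. 2 * (cmod (c r) * cmod (c s) * H r s))"
    by (simp only: mult_2 sum.distrib)
  also have "\<dots> \<le> (1 - \<epsilon>) * ((\<Sum>y\<in>Y. (cmod (c y))\<^sup>2) + (\<Sum>y'\<in>Y'. (cmod (c y'))\<^sup>2))"
  proof (rule bilinear_form_le)
    have "pi\<^sup>2 * (\<tau> / \<delta>)\<^sup>2 \<le> 12 * 1"
      using \<tau> \<delta>0 pi_squared_le_12 by (intro mult_mono power_le_one) (auto simp: \<delta>_def field_simps)
    then show "0 < 1 - \<epsilon>"
      by (simp add: \<epsilon>_def power_divide power_mult_distrib)
    show "\<exists>\<^sub>\<le>\<^sub>1 y'. y' \<in> Y' \<and> H y y' \<noteq> 0" if "y \<in> Y" for y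
      using one that far unfolding Uniq_def by (meson not_le)
    show "(\<Sum>y\<in>Y. (H y y')\<^sup>2) \<le> (1 - \<epsilon>)\<^sup>2" if "y' \<in> Y'" for y'
      unfolding H_def \<epsilon>_def power2_abs
      using that Y Y' \<delta>0 q \<tau> by (intro sum_dilated_kern_squares_le [where q = q]) (auto simp: \<delta>_def)
  qed (use Y Y' in auto)
  also have "(\<Sum>y\<in>Y. (cmod (c y))\<^sup>2) + (\<Sum>y'\<in>Y'. (cmod (c y'))\<^sup>2) = ?S"
    using Y Y' disj by (simp add: sum.union_disjoint)
  finally have "?S - (1 - \<epsilon>) * ?S \<le> \<delta> / 2 * ?F"
    using kern_minorant_inequality [OF _ N \<delta>_def, of "Y \<union> Y'" "\<lambda>y. y" c] \<delta> Y Y'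
    unfolding \<delta>_def [symmetric] H_def by force
  then have "2 / \<delta> * (\<epsilon> * ?S) \<le> ?F"
    using \<delta>0 by (simp add: field_simps)
  moreover have "2 / \<delta> * \<epsilon> = pi\<^sup>2 / (2 * 3 ^ 5) * (real N + 1) ^ 3 * \<tau>\<^sup>2"
    unfolding \<epsilon>_def \<delta>_def by (simp add: power_mult_distrib power_divide field_simps power2_eq_square power3_eq_cube)
  ultimately show ?thesis
    by (simp only: mult.assoc [of "2 / \<delta>" \<epsilon>, symmetric])
qed

text \<open>
  The rows \<open>k = 0\<close> and \<open>k = 1\<close> alone form a matrix whose Gram matrix has the diagonal entries \<open>2\<close> and off-diagonal entries of modulus
  \<open>|1 + exp(2\<pi>it)| = 2 |cos(\<pi>t)|\<close>, where \<open>t = y' - y\<close>.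
\<close>
lemma two_node_lower_bound:
  fixes c :: "real \<Rightarrow> complex"
  assumes N: "N \<ge> 2" and y: "y \<noteq> y'" "y \<in> {0..<1}" "y' \<in> {0..<1}"
  shows "pi\<^sup>2 / 2 * (wrap_dist y y')\<^sup>2 * (\<Sum>z\<in>{y, y'}. (cmod (c z))\<^sup>2)
     \<le> (\<Sum>k<N. (cmod (\<Sum>z\<in>{y, y'}. c z * cis (2 * pi * real k * z)))\<^sup>2)"
proof -
  define t where "t = y' - y"
  define w where "w = wrap_dist y y'"
  define u where "u = cis (2 * pi * t)"
  define S where "S = (cmod (c y))\<^sup>2 + (cmod (c y'))\<^sup>2"
  have t: "\<bar>t\<bar> \<le> 1" using y by (auto simp: t_def)
  have w: "w = min \<bar>t\<bar> (1 - \<bar>t\<bar>)"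
    using wrap_dist_eq_min [of y y'] t by (simp add: w_def t_def abs_minus_commute)
  have cw: "\<bar>cos (pi * t)\<bar> = cos (pi * w)"
  proof -
    have "\<bar>cos (pi * t)\<bar> = \<bar>cos (pi * \<bar>t\<bar>)\<bar>"
      by (simp add: abs_if)
    also have "\<dots> = \<bar>cos (pi * w)\<bar>"
      unfolding w min_def by (simp add: right_diff_distrib cos_diff)
    also have "\<dots> = cos (pi * w)"
    proof -
      have "0 \<le> w" "w \<le> 1 / 2"
        using t by (auto simp: w min_def)
      then have "0 \<le> pi * w" "pi * w \<le> pi / 2"
        by auto
      then show ?thesis
        by (intro abs_of_nonneg cos_ge_zero) linarith+
    qed
    finally show ?thesis .
  qed
  have u: "cmod (1 + u) = 2 * cos (pi * w)"
  proof -
    have "(cmod (1 + u))\<^sup>2 = 2 + 2 * cos (2 * (pi * t))"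
      by (simp add: u_def cmod_power2 power2_sum mult.assoc)
    also have "\<dots> = (2 * \<bar>cos (pi * t)\<bar>)\<^sup>2"
      by (simp add: cos_double_cos power_mult_distrib)
    finally have "cmod (1 + u) = 2 * \<bar>cos (pi * t)\<bar>"
      by (rule power2_eq_imp_eq) auto
    then show ?thesis
      by (simp only: cw)
  qed
  have "(cmod (\<Sum>z\<in>{y, y'}. c z * cis (2 * pi * real k * z)))\<^sup>2 = (cmod (c y + c y' * u ^ k))\<^sup>2" for k
  proof -
    have "(\<Sum>z\<in>{y, y'}. c z * cis (2 * pi * real k * z)) = cis (2 * pi * real k * y) * (c y + c y' * u ^ k)"
      using y(1) by (simp add: u_def t_def DeMoivre cis_mult algebra_simps)
    then show ?thesis by (simp add: norm_mult)
  qed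
  then have "(\<Sum>k<N. (cmod (\<Sum>z\<in>{y, y'}. c z * cis (2 * pi * real k * z)))\<^sup>2)
      = (\<Sum>k<N. (cmod (c y + c y' * u ^ k))\<^sup>2)" by simp
  also have "\<dots> \<ge> (\<Sum>k<2. (cmod (c y + c y' * u ^ k))\<^sup>2)"
    using N by (intro sum_mono2) auto
  also have "(\<Sum>k<2. (cmod (c y + c y' * u ^ k))\<^sup>2) = (cmod (c y + c y'))\<^sup>2 + (cmod (c y + c y' * u))\<^sup>2"
    by (simp add: numeral_2_eq_2)
  finally have "(cmod (c y + c y'))\<^sup>2 + (cmod (c y + c y' * u))\<^sup>2
      \<le> (\<Sum>k<N. (cmod (\<Sum>z\<in>{y, y'}. c z * cis (2 * pi * real k * z)))\<^sup>2)" .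
  moreover have "(cmod (c y + c y'))\<^sup>2 + (cmod (c y + c y' * u))\<^sup>2 = 2 * S + 2 * Re (c y' * cnj (c y) * (1 + u))"
  proof -
    have "(cmod (a + b))\<^sup>2 = (cmod a)\<^sup>2 + (cmod b)\<^sup>2 + 2 * Re (b * cnj a)" for a b
      unfolding cmod_power2 by (simp add: power2_eq_square algebra_simps)
    note this [of "c y" "c y'"] this [of "c y" "c y' * u"]
    moreover have "cmod u = 1" by (simp add: u_def)
    ultimately show ?thesis
      by (simp add: S_def norm_mult algebra_simps)
  qed
  moreover have "- (cmod (c y') * cmod (c y) * (2 * cos (pi * w))) \<le> Re (c y' * cnj (c y) * (1 + u))"
    using abs_Re_le_cmod [of "c y' * cnj (c y) * (1 + u)"] unfolding norm_mult u complex_mod_cnj by linarith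
  moreover have "cmod (c y') * cmod (c y) * (2 * cos (pi * w)) \<le> S * cos (pi * w)"
  proof -
    have "0 \<le> (cmod (c y') - cmod (c y))\<^sup>2 * cos (pi * w)"
      unfolding cw [symmetric] by simp
    then show ?thesis
      by (simp add: S_def power2_diff algebra_simps)
  qed
  moreover have "pi\<^sup>2 / 2 * w\<^sup>2 * S \<le> 2 * (1 - cos (pi * w)) * S"
  proof (rule mult_right_mono)
    have "(pi * w)\<^sup>2 / 4 \<le> 1 - cos (pi * w)"
      using t by (intro one_minus_cos_ge) (auto simp: w min_def)
    then show "pi\<^sup>2 / 2 * w\<^sup>2 \<le> 2 * (1 - cos (pi * w))"
      by (simp add: power_mult_distrib)
  qed (simp add: S_def)
  moreover have "2 * (1 - cos (pi * w)) * S = 2 * S - 2 * (S * cos (pi * w))"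
    by (simp add: algebra_simps)
  moreover have "(\<Sum>z\<in>{y, y'}. (cmod (c z))\<^sup>2) = S"
    using y(1) by (simp add: S_def)
  ultimately show ?thesis
    by (simp add: w_def)
qed

section \<open>Smallest singular values\<close>

definition norm_sq_vec :: "complex vec \<Rightarrow> real" where
  "norm_sq_vec v = (\<Sum>i<dim_vec v. (cmod (v $ i))\<^sup>2)"

lemma norm_sq_vec_pos:
  assumes "v \<in> carrier_vec n" "v \<noteq> 0\<^sub>v n"
  shows "norm_sq_vec v > 0"
proof -
  obtain i where "i < n" "v $ i \<noteq> 0"
    using assms by (metis eq_vecI carrier_vecD index_zero_vec)
  then show ?thesis
    using assms unfolding norm_sq_vec_def by (intro sum_pos2 [of _ i]) auto
qed

lemma dim_mat_adjoint [simp]: "dim_row (mat_adjoint A) = dim_col A" "dim_col (mat_adjoint A) = dim_row A"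
  by (simp_all add: mat_adjoint_def)

lemma index_mat_adjoint [simp]:
  fixes A :: "complex mat"
  shows "i < dim_col A \<Longrightarrow> j < dim_row A \<Longrightarrow> mat_adjoint A $$ (i, j) = cnj (A $$ (j, i))"
  by (simp add: mat_adjoint_def mat_of_rows_index)

lemma mat_adjoint_adjoint:
  fixes A :: "complex mat"
  shows "mat_adjoint (mat_adjoint A) = A"
  by (rule eq_matI) auto

lemma gram_eigenvalue:
  fixes A :: "complex mat"
  assumes A: "A \<in> carrier_mat n m" and v: "v \<in> carrier_vec m"
    and eig: "(mat_adjoint A * A) *\<^sub>v v = l \<cdot>\<^sub>v v"
  shows "l * of_real (norm_sq_vec v) = of_real (norm_sq_vec (A *\<^sub>v v))"
proof -
  have Ad: "mat_adjoint A \<in> carrier_mat m n" using A by auto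
  define w where "w = A *\<^sub>v v"
  have w: "w \<in> carrier_vec n" using A v by (simp add: w_def)
  have eig': "mat_adjoint A *\<^sub>v w = l \<cdot>\<^sub>v v"
    using eig assoc_mult_mat_vec [OF Ad A v] by (simp add: w_def)
  have "l * v $ i = (\<Sum>k<n. cnj (A $$ (k, i)) * w $ k)" if "i < m" for i
  proof -
    have "l * v $ i = (mat_adjoint A *\<^sub>v w) $ i"
      using v that by (simp add: eig')
    also have "\<dots> = (\<Sum>k<n. cnj (A $$ (k, i)) * w $ k)"
      using A w that by (simp add: scalar_prod_def lessThan_atLeast0)
    finally show ?thesis .
  qed
  then have "(\<Sum>i<m. l * v $ i * cnj (v $ i)) = (\<Sum>i<m. (\<Sum>k<n. cnj (A $$ (k, i)) * w $ k) * cnj (v $ i))"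
    by simp
  also have "\<dots> = (\<Sum>k<n. w $ k * (\<Sum>i<m. cnj (A $$ (k, i)) * cnj (v $ i)))"
    unfolding sum_distrib_left sum_distrib_right by (subst sum.swap) (simp add: mult_ac)
  also have "\<dots> = (\<Sum>k<n. w $ k * cnj (w $ k))"
  proof (rule sum.cong)
    fix k
    assume "k \<in> {..<n}"
    then have "w $ k = (\<Sum>i<m. A $$ (k, i) * v $ i)"
      using A v by (simp add: w_def scalar_prod_def lessThan_atLeast0)
    then show "w $ k * (\<Sum>i<m. cnj (A $$ (k, i)) * cnj (v $ i)) = w $ k * cnj (w $ k)"
      by simp
  qed simp
  finally have "l * (\<Sum>i<m. v $ i * cnj (v $ i)) = (\<Sum>k<n. w $ k * cnj (w $ k))"
    by (simp add: sum_distrib_left mult.assoc)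
  then show ?thesis
    using v w by (simp add: norm_sq_vec_def complex_norm_square flip: w_def del: of_real_power)
qed

text \<open>
  The quadratic form \<open>|Av|\<^sup>2\<close> forces the eigenvalues of the Gram matrix to be real and nonnegative, so each of them is the square of a
  singular value. A complex matrix of positive size has an eigenvalue, and only finitely many.
\<close>
lemma gram_singular_values:
  fixes A :: "complex mat"
  assumes A: "A \<in> carrier_mat n m" and m: "m > 0"
  defines "S \<equiv> {s. 0 \<le> s \<and> eigenvalue (mat_adjoint A * A) (complex_of_real (s\<^sup>2))}"
  shows "finite S" "S \<noteq> {}"
    and "s \<in> S \<Longrightarrow> \<exists>v\<in>carrier_vec m. v \<noteq> 0\<^sub>v m \<and> s\<^sup>2 * norm_sq_vec v = norm_sq_vec (A *\<^sub>v v)"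
proof -
  let ?G = "mat_adjoint A * A"
  have G: "?G \<in> carrier_mat m m" using A by auto
  have eig: "\<exists>v\<in>carrier_vec m. v \<noteq> 0\<^sub>v m \<and> l * of_real (norm_sq_vec v) = of_real (norm_sq_vec (A *\<^sub>v v))"
    if "eigenvalue ?G l" for l
    using that gram_eigenvalue [OF A] G A unfolding eigenvalue_def eigenvector_def by auto
  have "inj_on (\<lambda>s. complex_of_real (s\<^sup>2)) S"
    by (rule inj_onI) (auto simp: S_def simp del: of_real_power)
  moreover have "(\<lambda>s. complex_of_real (s\<^sup>2)) ` S \<subseteq> spectrum ?G"
    by (auto simp: S_def spectrum_def)
  ultimately show "finite S"
    using card_finite_spectrum(1) [OF G] by (rule inj_on_finite)
  obtain l where l: "eigenvalue ?G l"
    using spectrum_non_empty [OF G m] by (auto simp: spectrum_def)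
  from eig [OF this] obtain v where v: "v \<in> carrier_vec m" "v \<noteq> 0\<^sub>v m"
    "l * of_real (norm_sq_vec v) = of_real (norm_sq_vec (A *\<^sub>v v))" by blast
  define r where "r = norm_sq_vec (A *\<^sub>v v) / norm_sq_vec v"
  have "l = of_real r"
    using v(3) norm_sq_vec_pos [OF v(1,2)] by (simp add: r_def field_simps)
  moreover have "r \<ge> 0"
    unfolding r_def norm_sq_vec_def by (intro divide_nonneg_nonneg sum_nonneg) auto
  ultimately have "sqrt r \<in> S"
    using l by (simp add: S_def flip: of_real_power)
  then show "S \<noteq> {}" by blast
  show "\<exists>v\<in>carrier_vec m. v \<noteq> 0\<^sub>v m \<and> s\<^sup>2 * norm_sq_vec v = norm_sq_vec (A *\<^sub>v v)" if "s \<in> S"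
  proof -
    from that have "eigenvalue ?G (complex_of_real (s\<^sup>2))" by (simp add: S_def)
    from eig [OF this] show ?thesis
      by (metis of_real_eq_iff of_real_mult)
  qed
qed

lemma sigma_min_attained_tall:
  assumes A: "A \<in> carrier_mat n m" and m: "m > 0" "m \<le> n"
  shows "\<exists>v\<in>carrier_vec m. v \<noteq> 0\<^sub>v m \<and> (sigma_min A)\<^sup>2 * norm_sq_vec v = norm_sq_vec (A *\<^sub>v v)"
proof -
  let ?S = "{s. 0 \<le> s \<and> eigenvalue (mat_adjoint A * A) (complex_of_real (s\<^sup>2))}"
  have "singular_values A = ?S"
    using A m by (simp add: singular_values_def)
  then have "sigma_min A \<in> ?S"
    unfolding sigma_min_def using Min_in [OF gram_singular_values(1,2) [OF A m(1)]] by (simp only:)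
  then show ?thesis
    by (rule gram_singular_values(3) [OF A m(1)])
qed

lemma sigma_min_attained_wide:
  assumes A: "A \<in> carrier_mat n m" and n: "n > 0" "n < m"
  shows "\<exists>v\<in>carrier_vec n. v \<noteq> 0\<^sub>v n \<and> (sigma_min A)\<^sup>2 * norm_sq_vec v = norm_sq_vec (mat_adjoint A *\<^sub>v v)"
proof -
  have Ad: "mat_adjoint A \<in> carrier_mat m n" using A by auto
  let ?S = "{s. 0 \<le> s \<and> eigenvalue (mat_adjoint (mat_adjoint A) * mat_adjoint A) (complex_of_real (s\<^sup>2))}"
  have "singular_values A = ?S"
    using A n by (simp add: singular_values_def mat_adjoint_adjoint)
  then have "sigma_min A \<in> ?S"
    unfolding sigma_min_def using Min_in [OF gram_singular_values(1,2) [OF Ad n(1)]] by (simp only:)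
  then show ?thesis
    by (rule gram_singular_values(3) [OF Ad n(1)])
qed

text \<open>
  Padding \<open>A\<close> with zero rows to a square matrix makes the determinant vanish.
\<close>
lemma wide_mat_kernel:
  fixes A :: "complex mat"
  assumes A: "A \<in> carrier_mat n m" and nm: "n < m"
  shows "\<exists>v\<in>carrier_vec m. v \<noteq> 0\<^sub>v m \<and> A *\<^sub>v v = 0\<^sub>v n"
proof -
  define c where "c i = (if i < n then row A i else 0\<^sub>v m)" for i
  define P where "P = mat\<^sub>r m m (\<lambda>i. if i = n then 0\<^sub>v m else c i)"
  have P: "P \<in> carrier_mat m m" by (simp add: P_def)
  have "det P = 0"
    unfolding P_def using A nm by (intro det_row_0) (auto simp: c_def)
  then obtain v where v: "v \<in> carrier_vec m" "v \<noteq> 0\<^sub>v m" "P *\<^sub>v v = 0\<^sub>v m"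
    using det_0_iff_vec_prod_zero_field [OF P] by blast
  have "A *\<^sub>v v = 0\<^sub>v n"
  proof (rule eq_vecI)
    fix i
    assume "i < dim_vec (0\<^sub>v n :: complex vec)"
    then have i: "i < n" by simp
    then have "row P i = row A i"
      using A nm by (intro eq_vecI) (auto simp: P_def c_def)
    moreover have "(P *\<^sub>v v) $ i = row P i \<bullet> v"
      using P i nm by simp
    ultimately show "(A *\<^sub>v v) $ i = 0\<^sub>v n $ i"
      using A i nm v(3) by simp
  qed (use A in auto)
  with v show ?thesis by blast
qed

text \<open>
  A positive lower bound makes the matrix injective, so it cannot have more columns than rows, and the smallest singular value is taken
  from the Gram matrix of its columns.
\<close>
lemma sigma_min_squared_ge:
  assumes A: "A \<in> carrier_mat n m" and m: "m > 0" and b: "b > 0"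
    and bound: "\<And>v. v \<in> carrier_vec m \<Longrightarrow> b * norm_sq_vec v \<le> norm_sq_vec (A *\<^sub>v v)"
  shows "b \<le> (sigma_min A)\<^sup>2"
proof -
  have "m \<le> n"
  proof (rule ccontr)
    assume "\<not> m \<le> n"
    then obtain v where "v \<in> carrier_vec m" "v \<noteq> 0\<^sub>v m" "A *\<^sub>v v = 0\<^sub>v n"
      using wide_mat_kernel [OF A] by auto
    then show False
      using bound [of v] norm_sq_vec_pos [of v m] b by (simp add: norm_sq_vec_def mult_le_0_iff)
  qed
  then obtain v where v: "v \<in> carrier_vec m" "v \<noteq> 0\<^sub>v m"
      "(sigma_min A)\<^sup>2 * norm_sq_vec v = norm_sq_vec (A *\<^sub>v v)"
    using sigma_min_attained_tall [OF A m] by blast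
  then show ?thesis
    using bound [OF v(1)] norm_sq_vec_pos [OF v(1,2)] by (metis mult_le_cancel_right_pos)
qed

lemma vandermonde_carrier: "vandermonde_mat N zs \<in> carrier_mat N (length zs)"
  by (simp add: vandermonde_mat_def)

lemma vandermonde_index:
  assumes "k < N" "j < length zs"
  shows "vandermonde_mat N zs $$ (k, j) = cis (2 * pi * real k * zs ! j)"
  using assms by (simp add: vandermonde_mat_def cis_conv_exp mult_ac)

lemma sigma_min_vandermonde_ge:
  assumes zs: "zs \<noteq> []" "distinct zs" and b: "b > 0"
    and bound: "\<And>c. b * (\<Sum>y\<in>set zs. (cmod (c y))\<^sup>2)
        \<le> (\<Sum>k<N. (cmod (\<Sum>y\<in>set zs. c y * cis (2 * pi * real k * y)))\<^sup>2)"
  shows "b \<le> (sigma_min (vandermonde_mat N zs))\<^sup>2"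
proof (rule sigma_min_squared_ge [OF vandermonde_carrier _ b])
  show "length zs > 0" using zs by simp
  fix v :: "complex vec"
  assume v: "v \<in> carrier_vec (length zs)"
  let ?ix = "the_inv_into {..<length zs} ((!) zs)"
  have bij: "bij_betw ((!) zs) {..<length zs} (set zs)"
    using zs(2) by (rule bij_betw_nth) auto
  have ix: "?ix (zs ! i) = i" if "i < length zs" for i
    using bij that by (intro the_inv_into_f_f) (auto simp: bij_betw_def)
  have "norm_sq_vec v = (\<Sum>y\<in>set zs. (cmod (v $ ?ix y))\<^sup>2)"
    using v ix by (simp add: norm_sq_vec_def flip: sum.reindex_bij_betw [OF bij])
  moreover have "(vandermonde_mat N zs *\<^sub>v v) $ k = (\<Sum>y\<in>set zs. v $ ?ix y * cis (2 * pi * real k * y))"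
    if "k < N" for k
  proof -
    have "(vandermonde_mat N zs *\<^sub>v v) $ k = (\<Sum>i<length zs. cis (2 * pi * real k * zs ! i) * v $ i)"
      using that v vandermonde_carrier [of N zs]
      by (simp add: scalar_prod_def lessThan_atLeast0 vandermonde_index)
    then show ?thesis
      using ix by (simp add: mult.commute flip: sum.reindex_bij_betw [OF bij])
  qed
  then have "norm_sq_vec (vandermonde_mat N zs *\<^sub>v v)
      = (\<Sum>k<N. (cmod (\<Sum>y\<in>set zs. v $ ?ix y * cis (2 * pi * real k * y)))\<^sup>2)"
    using vandermonde_carrier [of N zs] by (simp add: norm_sq_vec_def)
  ultimately show "b * norm_sq_vec v \<le> norm_sq_vec (vandermonde_mat N zs *\<^sub>v v)"
    using bound by simp
qed

text \<open>
  All entries of the row are \<open>1\<close>, and its Gram matrix is the number of nodes.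
\<close>
lemma sigma_min_vandermonde_one_row:
  assumes "length zs \<ge> 2"
  shows "(sigma_min (vandermonde_mat 1 zs))\<^sup>2 = real (length zs)"
proof -
  let ?V = "vandermonde_mat 1 zs"
  have V: "?V \<in> carrier_mat 1 (length zs)" by (rule vandermonde_carrier)
  obtain v where v: "v \<in> carrier_vec 1" "v \<noteq> 0\<^sub>v 1"
      "(sigma_min ?V)\<^sup>2 * norm_sq_vec v = norm_sq_vec (mat_adjoint ?V *\<^sub>v v)"
    using sigma_min_attained_wide [OF V] assms by auto
  have "(mat_adjoint ?V *\<^sub>v v) $ j = v $ 0" if "j < length zs" for j
    using that V v(1) by (simp add: scalar_prod_def vandermonde_index)
  then have "norm_sq_vec (mat_adjoint ?V *\<^sub>v v) = real (length zs) * norm_sq_vec v"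
    using V v(1) by (simp add: norm_sq_vec_def)
  then show ?thesis
    using v(3) norm_sq_vec_pos [OF v(1,2)] by simp
qed

section \<open>The bound for the Vandermonde matrix of two separated sets\<close>

theorem corollary4p2:
  fixes N :: nat and q \<tau> :: real and ys ys' :: "real list"
  assumes "N \<ge> 1"
    and "q \<ge> 3 / (real N + 1)"
    and "ys \<noteq> []" and "distinct ys" and "set ys \<subseteq> {0..<1}"
    and "ys' \<noteq> []" and "distinct ys'" and "set ys' \<subseteq> {0..<1}"
    and "q_separated q (set ys)" and "q_separated q (set ys')"
    and "\<forall>y\<in>set ys. \<exists>\<^sub>\<le>\<^sub>1 y'. y' \<in> set ys' \<and> wrap_dist y y' < q"
    and "\<tau> = wrap_set_dist (set ys) (set ys')"
  shows "(\<tau> < 3 / (real N + 1) \<longrightarrow>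
            (sigma_min (vandermonde_mat N (ys @ ys')))\<^sup>2 \<ge> pi\<^sup>2 / (2 * 3 ^ 5) * (real N + 1) ^ 3 * \<tau>\<^sup>2)
       \<and> (\<not> \<tau> < 3 / (real N + 1) \<longrightarrow>
            (sigma_min (vandermonde_mat N (ys @ ys')))\<^sup>2 \<ge> 2 / 3 * (real N + 1))"
proof -
  let ?Y = "set ys" and ?Y' = "set ys'" and ?\<delta> = "3 / (real N + 1)"
  let ?b = "pi\<^sup>2 / (2 * 3 ^ 5) * (real N + 1) ^ 3 * \<tau>\<^sup>2"
  let ?D = "{wrap_dist y y' | y y'. y \<in> ?Y \<and> y' \<in> ?Y'}"
  have D: "?D = (\<lambda>(y, y'). wrap_dist y y') ` (?Y \<times> ?Y')" by auto
  then have fin: "finite ?D" by simp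
  have \<tau>_le: "\<tau> \<le> wrap_dist y y'" if "y \<in> ?Y" "y' \<in> ?Y'" for y y'
    unfolding assms(12) wrap_set_dist_def using that by (intro Min_le fin) blast
  have "?D \<noteq> {}" unfolding D using assms(3,6) by simp
  then have "\<tau> \<in> ?D"
    unfolding assms(12) wrap_set_dist_def using fin by (intro Min_in)
  then obtain y0 y0' where y0: "y0 \<in> ?Y" "y0' \<in> ?Y'" and \<tau>: "\<tau> = wrap_dist y0 y0'" by blast
  have \<tau>0: "0 \<le> \<tau>"
    unfolding \<tau> by (rule wrap_dist_nonneg)
  have \<tau>_half: "\<tau> \<le> 1 / 2"
    unfolding \<tau> using y0 assms(5,8) by (intro wrap_dist_le_half) auto
  have distinct: "distinct (ys @ ys')" and disj: "?Y \<inter> ?Y' = {}" if "\<tau> > 0"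
  proof -
    show "?Y \<inter> ?Y' = {}"
      using \<tau>_le that by (fastforce simp: wrap_dist_self)
    then show "distinct (ys @ ys')" using assms(4,7) by simp
  qed
  have clustered: "?b \<le> (sigma_min (vandermonde_mat N (ys @ ys')))\<^sup>2" if "\<tau> < ?\<delta>"
  proof (cases "\<tau> = 0")
    case False
    with \<tau>0 have pos: "\<tau> > 0" by simp
    then have b: "?b > 0" by simp
    consider "N = 1" | "2 \<le> N" "N \<le> 4" | "N \<ge> 5" using assms(1) by linarith
    then show ?thesis
    proof cases
      case 1
      have "pi\<^sup>2 * \<tau>\<^sup>2 \<le> 12 * 1"
        using pi_squared_le_12 \<tau>0 \<tau>_half by (intro mult_mono power_le_one) auto
      then have "?b \<le> 2" by (simp add: 1)
      also have "2 \<le> real (length (ys @ ys'))"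
        using assms(3,6) by (cases ys; cases ys') auto
      also have "\<dots> = (sigma_min (vandermonde_mat N (ys @ ys')))\<^sup>2"
        unfolding 1 using assms(3,6) by (subst sigma_min_vandermonde_one_row) (cases ys; cases ys'; auto)+
      finally show ?thesis .
    next
      case 2
      have "1 / 2 < ?\<delta>" using 2(2) by (simp add: field_simps)
      then have q: "q > 1 / 2" using assms(2) by linarith
      have sets: "?Y = {y0}" "?Y' = {y0'}"
        using q_separated_singleton [OF assms(9) q assms(5)] q_separated_singleton [OF assms(10) q assms(8)] y0 by auto
      have un: "set (ys @ ys') = {y0, y0'}" using sets by auto
      (* \<open>(N+1)\<^sup>3 \<le> 125 \<le> 3\<^sup>5\<close> *)
      have "?b \<le> pi\<^sup>2 / 2 * \<tau>\<^sup>2"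
      proof -
        have "(real N + 1) ^ 3 \<le> 5 ^ 3" using 2(2) by (intro power_mono) auto
        then have "pi\<^sup>2 / (2 * 3 ^ 5) * (real N + 1) ^ 3 * \<tau>\<^sup>2 \<le> pi\<^sup>2 / (2 * 3 ^ 5) * 3 ^ 5 * \<tau>\<^sup>2"
          by (intro mult_right_mono mult_left_mono) auto
        then show ?thesis by simp
      qed
      also have "\<dots> \<le> (sigma_min (vandermonde_mat N (ys @ ys')))\<^sup>2"
      proof (rule sigma_min_vandermonde_ge [OF _ distinct [OF pos]], unfold un)
        show "pi\<^sup>2 / 2 * \<tau>\<^sup>2 * (\<Sum>z\<in>{y0, y0'}. (cmod (c z))\<^sup>2)
            \<le> (\<Sum>k<N. (cmod (\<Sum>z\<in>{y0, y0'}. c z * cis (2 * pi * real k * z)))\<^sup>2)" for c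
          unfolding \<tau> using 2(1) y0 disj [OF pos] assms(5,8) by (intro two_node_lower_bound) auto
      qed (use pos assms(3) in auto)
      finally show ?thesis .
    next
      case 3
      then have "?\<delta> \<le> 1 / 2" by (simp add: field_simps)
      then show ?thesis
        using assms(3) that \<tau>_le \<tau>0
        by (intro sigma_min_vandermonde_ge [OF _ distinct [OF pos] b], simp, unfold set_append)
           (intro clustered_lower_bound [where q = q] assms disj [OF pos]; simp)
    qed
  qed simp
  have separated: "2 / 3 * (real N + 1) \<le> (sigma_min (vandermonde_mat N (ys @ ys')))\<^sup>2" if "\<not> \<tau> < ?\<delta>"
  proof -
    have \<delta>: "?\<delta> \<le> \<tau>" "?\<delta> \<le> 1 / 2"
      using that \<tau>_half by linarith+
    then have pos: "\<tau> > 0" by (smt (verit) divide_pos_pos of_nat_0_le_iff)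
    have cross: "?\<delta> \<le> wrap_dist y y' \<and> ?\<delta> \<le> wrap_dist y' y" if yy: "y \<in> ?Y" "y' \<in> ?Y'" for y y'
    proof -
      have "y \<in> {0..<1}" "y' \<in> {0..<1}" using yy assms(5,8) by auto
      then have "wrap_dist y y' = wrap_dist y' y" by (intro wrap_dist_commute) auto
      then show ?thesis using \<tau>_le [OF yy] \<delta> by simp
    qed
    have "q_separated ?\<delta> (?Y \<union> ?Y')"
      using assms(2,9,10) cross unfolding q_separated_def by (meson UnE order_trans)
    then show ?thesis
      using assms(1,3,5,8) \<delta>(2)
      by (intro sigma_min_vandermonde_ge [OF _ distinct [OF pos]], simp, simp, unfold set_append)
         (intro separated_lower_bound; simp)
  qed
  show ?thesis using clustered separated by blast
qed

end
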